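(* Let $d\ge2$, let $\Omega_{ext}\subset\mathbf Z^d$ be a connected exterior domain, and let $\widehat V$ be a real-valued compactly supported potential on $\Omega_{ext}$. (1) Let $\widehat H^{(R)}_{ext}$ be the Schrödinger operator $-\Delta_{disc}+\widehat V$ in $\Omega_{ext}$ with the Robin boundary condition given by a bounded real function $c$ on $\partial\Omega_{ext}$. If $\Omega_{ext}$ satisfies the cone condition, then $\sigma_p(\widehat H^{(R)}_{ext})\cap(0,d)=\emptyset$. (2) Let $\widehat H^{(D)}_{ext}$ be the Schrödinger operator $-\Delta_{disc}+\widehat V$ in $\Omega_{ext}$ with the Dirichlet boundary condition. If for every $n\in\stackrel{\circ}{\Omega}_{ext}$ there is a cone $C_{i,+}(n)$ (or $C_{i,-}(n)$) such that $C_{i,+}(n)\subset\Omega_{ext}$ (or $C_{i,-}(n)\subset\Omega_{ext}$), then $\sigma_p(\widehat H^{(D)}_{ext})\cap(0,d)=\emptyset$.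
   Context: $\mathbf Z^d$ is the square lattice with standard basis $e_1,\dots,e_d$, $|n|=(\sum_{i=1}^d n_i^2)^{1/2}$, and $$(\Delta_{disc}\widehat u)(n)=\frac14\sum_{j=1}^d\big(\widehat u(n+e_j)+\widehat u(n-e_j)\big)-\frac d2\,\widehat u(n).$$ A subset $\Omega\subset\mathbf Z^d$ is connected if for any $m,n\in\Omega$ there is a sequence $n^{(0)}=m,\dots,n^{(k)}=n$ in $\Omega$ with $|n^{(\ell)}-n^{(\ell+1)}|=1$ for $0\le\ell\le k-1$. For $n\in\Omega$ put $\deg_\Omega(n)=\#\{m\in\Omega:|m-n|=1\}$, and $$\stackrel{\circ}{\Omega}=\{n\in\Omega:\deg_\Omega(n)=2d\},\qquad \partial\Omega=\{n\in\Omega:\deg_\Omega(n)<2d\}.$$ An exterior domain is a set $\Omega_{ext}=\mathbf Z^d\setminus\stackrel{\circ}{\Omega}_{int}$ for some bounded set $\Omega_{int}\subset\mathbf Z^d$. The normal derivative on $\partial\Omega$ is $$\partial_\nu\widehat u(n)=\frac14\sum_{m\in\stackrel{\circ}{\Omega},\,|m-n|=1}\big(\widehat u(n)-\widehat u(m)\big),\qquad n\in\partial\Omega.$$ For $1\le i\le d$ and $n\in\mathbf Z^d$ define the cones $$C_{i,\pm}(n)=\Big\{m\in\mathbf Z^d:\ \sum_{k\ne i}|m_k-n_k|\le\pm(m_i-n_i)\Big\}.$$ $\Omega_{ext}$ satisfies the cone condition if for every $n\in\Omega_{ext}$ there is a cone $C_{i,+}(n)$ or $C_{i,-}(n)$ (for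 some $i$) contained in $\Omega_{ext}$. Dirichlet operator: $\widehat H^{(D)}_{ext}$ is the bounded self-adjoint operator on $\ell^2(\stackrel{\circ}{\Omega}_{ext})$ given by $(\widehat H^{(D)}_{ext}\widehat u)(n)=(-\Delta_{disc}\widehat u)(n)+\widehat V(n)\widehat u(n)$ for $n\in\stackrel{\circ}{\Omega}_{ext}$, where $\widehat u$ is extended to $\partial\Omega_{ext}$ by the Dirichlet condition $\widehat u(n)=0$, $n\in\partial\Omega_{ext}$. Robin operator: the Robin condition is $(\partial_\nu\widehat u)(n)+c(n)\widehat u(n)=0$ on $\partial\Omega_{ext}$, with $c$ a bounded real function. $\widehat H^{(R)}_{ext}$ is understood as the bounded self-adjoint operator on $\ell^2(\Omega_{ext})$ obtained from the graph Laplacian: $(\widehat H^{(R)}_{ext}\widehat u)(n)=(-\Delta_{disc}\widehat u)(n)+\widehat V(n)\widehat u(n)$ for $n\in\stackrel{\circ}{\Omega}_{ext}$, and $(\widehat H^{(R)}_{ext}\widehat u)(n)=(\partial_\nu\widehat u)(n)+c(n)\widehat u(n)+\widehat V(n)\widehat u(n)$ for $n\in\partial\Omega_{ext}$. $\sigma_p$ denotes the point spectrum (the set of eigenvalues). *)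

theory Defs
  imports "HOL-Analysis.Analysis"
begin

text \<open>The lattice \<open>\<int>\<^sup>d\<close> is the type \<^typ>\<open>int ^ 'd\<close> with \<open>d = CARD('d)\<close>; the basis vector
  \<open>e\<^sub>j\<close> is \<^term>\<open>axis j 1\<close>.\<close>

definition lattice_norm :: "int ^ 'd \<Rightarrow> real" where
  "lattice_norm n = sqrt (\<Sum>i\<in>UNIV. (real_of_int (n $ i))\<^sup>2)"

definition lattice_bounded :: "(int ^ 'd) set \<Rightarrow> bool" where
  "lattice_bounded \<Omega> \<longleftrightarrow> (\<exists>R. \<forall>n\<in>\<Omega>. lattice_norm n \<le> R)"

definition lattice_connected :: "(int ^ 'd) set \<Rightarrow> bool" where
  "lattice_connected \<Omega> \<longleftrightarrow>
     (\<forall>m\<in>\<Omega>. \<forall>n\<in>\<Omega>. \<exists>(k::nat) (p :: nat \<Rightarrow> int ^ 'd).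
        p 0 = m \<and> p k = n \<and> (\<forall>l\<le>k. p l \<in> \<Omega>) \<and>
        (\<forall>l<k. lattice_norm (p l - p (Suc l)) = 1))"

definition deg :: "(int ^ 'd) set \<Rightarrow> int ^ 'd \<Rightarrow> nat" where
  "deg \<Omega> n = card {m \<in> \<Omega>. lattice_norm (m - n) = 1}"

definition lattice_interior :: "(int ^ 'd) set \<Rightarrow> (int ^ 'd) set" where
  "lattice_interior \<Omega> = {n \<in> \<Omega>. deg \<Omega> n = 2 * CARD('d)}"

definition lattice_boundary :: "(int ^ 'd) set \<Rightarrow> (int ^ 'd) set" where
  "lattice_boundary \<Omega> = {n \<in> \<Omega>. deg \<Omega> n < 2 * CARD('d)}"

definition exterior_domain :: "(int ^ 'd) set \<Rightarrow> bool" where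
  "exterior_domain \<Omega> \<longleftrightarrow> (\<exists>\<Omega>int. lattice_bounded \<Omega>int \<and> \<Omega> = - lattice_interior \<Omega>int)"

text \<open>Finiteness of neighbourhoods: the cardinality in \<^const>\<open>deg\<close> and the sum in the normal
  derivative below range over finite sets.\<close>

lemma finite_lattice_sphere: "finite {m :: int ^ 'd. lattice_norm (m - n) = 1}"
proof -
  let ?I = "{f :: 'd \<Rightarrow> int. \<forall>i. f i \<in> {n $ i - 1..n $ i + 1}}"
  have fin: "finite ?I"
    using finite_PiE[of UNIV "\<lambda>i. {n $ i - 1..n $ i + 1}"] by (simp add: PiE_UNIV_domain Pi_def)
  have "{m. lattice_norm (m - n) = 1} \<subseteq> vec_lambda ` ?I"
  proof
    fix m assume "m \<in> {m. lattice_norm (m - n) = 1}"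
    hence s: "(\<Sum>i\<in>UNIV. (real_of_int ((m - n) $ i))\<^sup>2) = 1"
      by (simp add: lattice_norm_def)
    have "m $ i \<in> {n $ i - 1..n $ i + 1}" for i
    proof -
      have "(real_of_int ((m - n) $ i))\<^sup>2 \<le> 1"
        unfolding s[symmetric] by (rule member_le_sum) auto
      hence "\<bar>real_of_int ((m - n) $ i)\<bar> \<le> 1" by (simp add: abs_square_le_1)
      hence "\<bar>(m - n) $ i\<bar> \<le> 1" by linarith
      thus ?thesis by auto
    qed
    thus "m \<in> vec_lambda ` ?I"
      by (intro image_eqI[of _ _ "vec_nth m"]) (simp_all add: vec_lambda_eta)
  qed
  thus ?thesis using fin finite_surj by blast
qed

definition cone_plus :: "'d \<Rightarrow> int ^ 'd \<Rightarrow> (int ^ 'd) set" where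
  "cone_plus i n = {m. (\<Sum>k\<in>UNIV - {i}. \<bar>m $ k - n $ k\<bar>) \<le> m $ i - n $ i}"

definition cone_minus :: "'d \<Rightarrow> int ^ 'd \<Rightarrow> (int ^ 'd) set" where
  "cone_minus i n = {m. (\<Sum>k\<in>UNIV - {i}. \<bar>m $ k - n $ k\<bar>) \<le> - (m $ i - n $ i)}"

definition cone_condition :: "(int ^ 'd) set \<Rightarrow> bool" where
  "cone_condition \<Omega> \<longleftrightarrow> (\<forall>n\<in>\<Omega>. \<exists>i. cone_plus i n \<subseteq> \<Omega> \<or> cone_minus i n \<subseteq> \<Omega>)"

definition laplacian :: "(int ^ 'd \<Rightarrow> complex) \<Rightarrow> int ^ 'd \<Rightarrow> complex" where
  "laplacian u n =
     1/4 * (\<Sum>j\<in>UNIV. u (n + axis j 1) + u (n - axis j 1)) - of_nat CARD('d) / 2 * u n"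

definition normal_deriv :: "(int ^ 'd) set \<Rightarrow> (int ^ 'd \<Rightarrow> complex) \<Rightarrow> int ^ 'd \<Rightarrow> complex" where
  "normal_deriv \<Omega> u n =
     1/4 * (\<Sum>m\<in>{m \<in> lattice_interior \<Omega>. lattice_norm (m - n) = 1}. u n - u m)"

text \<open>An element of \<open>\<ell>\<^sup>2(S)\<close> is represented by its extension by zero to the whole lattice.\<close>

definition ell2_on :: "(int ^ 'd) set \<Rightarrow> (int ^ 'd \<Rightarrow> complex) set" where
  "ell2_on S = {u. (\<forall>n. n \<notin> S \<longrightarrow> u n = 0) \<and> (\<lambda>n. (cmod (u n))\<^sup>2) summable_on S}"

text \<open>Acting on \<open>\<ell>\<^sup>2(interior of \<Omega>)\<close>. Every neighbour of an interior point lies in \<open>\<Omega>\<close>, and an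
  element of this space vanishes on the boundary of \<open>\<Omega>\<close>, which is the Dirichlet condition.\<close>

definition dirichlet_op ::
  "(int ^ 'd) set \<Rightarrow> (int ^ 'd \<Rightarrow> real) \<Rightarrow> (int ^ 'd \<Rightarrow> complex) \<Rightarrow> int ^ 'd \<Rightarrow> complex" where
  "dirichlet_op \<Omega> V u n =
     (if n \<in> lattice_interior \<Omega> then - laplacian u n + of_real (V n) * u n else 0)"

text \<open>Acting on \<open>\<ell>\<^sup>2(\<Omega>)\<close>.\<close>

definition robin_op ::
  "(int ^ 'd) set \<Rightarrow> (int ^ 'd \<Rightarrow> real) \<Rightarrow> (int ^ 'd \<Rightarrow> real) \<Rightarrow>
     (int ^ 'd \<Rightarrow> complex) \<Rightarrow> int ^ 'd \<Rightarrow> complex" where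
  "robin_op \<Omega> c V u n =
     (if n \<in> lattice_interior \<Omega> then - laplacian u n + of_real (V n) * u n
      else if n \<in> lattice_boundary \<Omega>
        then normal_deriv \<Omega> u n + of_real (c n) * u n + of_real (V n) * u n
      else 0)"

definition point_spectrum ::
  "(int ^ 'd) set \<Rightarrow> ((int ^ 'd \<Rightarrow> complex) \<Rightarrow> int ^ 'd \<Rightarrow> complex) \<Rightarrow> complex set" where
  "point_spectrum S H =
     {z. \<exists>u\<in>ell2_on S. u \<noteq> (\<lambda>n. 0) \<and> H u = (\<lambda>n. z * u n)}"

end

theory Submission
  imports Defs "HOL-Computational_Algebra.Polynomial" "HOL-Probability.Infinite_Product_Measure"
begin

text \<open>An \<open>\<ell>\<^sup>2\<close> eigenfunction \<open>u\<close> with eigenvalue \<open>E\<close>, extended by zero, satisfies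
  \<open>(\<Delta> + E) u = g\<close> on all of \<open>\<int>\<^sup>d\<close> with \<open>g\<close> finitely supported. Once \<open>u\<close> is known to be finitely
  supported too, it vanishes at the apex of any cone in \<open>\<Omega>\<close>, by solving the equation layer by layer
  from infinity towards the apex.

  For the finite support fix a coordinate \<open>i\<close> and write \<open>u\<^sub>k\<close> for the translate of \<open>u\<close> by \<open>k e\<^sub>i\<close>,
  so that \<open>u\<^bsub>k+1\<^esub> + u\<^bsub>k-1\<^esub> = C u\<^sub>k + f\<^sub>k\<close>, where \<open>C\<close> acts on the transversal variables only. With
  \<open>P\<^sub>k\<close> one of the two Chebyshev families (\<open>P\<^bsub>k+1\<^esub> = X P\<^sub>k - P\<^bsub>k-1\<^esub>\<close>), Green's formula gives
  \<open>\<Sum>\<^bsub>k \<le> K\<^esub> P\<^sub>k(C) f\<^sub>k = P\<^sub>K(C) u\<^bsub>K+1\<^esub> - P\<^bsub>K+1\<^esub>(C) u\<^sub>K\<close> up to boundary terms at \<open>k = 0\<close>, which cancel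
  against those of the half space \<open>k \<le> 0\<close>. As \<open>0 < E < d\<close>, there is an open set of transversal
  frequencies where the symbol of \<open>C\<close> lies strictly between \<open>-2\<close> and \<open>2\<close>; there the \<open>P\<^sub>K\<close> are
  bounded in \<open>K\<close> while \<open>u\<^sub>K \<rightarrow> 0\<close> in \<open>\<ell>\<^sup>2\<close>. So the trigonometric polynomials
  \<open>\<Sum>\<^sub>k P\<^sub>k(C) f\<^sub>k\<close> vanish on an open set, hence identically. This yields
  \<open>T\<^sub>K(C) u\<^sub>0 = u\<^sub>K + u\<^bsub>-K\<^esub>\<close> for large \<open>K\<close>, and
  \<open>2 \<parallel>u\<^sub>0\<parallel>\<^sup>2 = \<parallel>T\<^sub>K(C) u\<^sub>0\<parallel>\<^sup>2 - \<langle>T\<^bsub>2K\<^esub>(C) u\<^sub>0, u\<^sub>0\<rangle> \<rightarrow> 0\<close> because \<open>T\<^sub>K\<^sup>2 = T\<^bsub>2K\<^esub> + 2\<close>.\<close>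

section \<open>Square summable functions on a set\<close>

definition square_summable_on :: "('a \<Rightarrow> complex) \<Rightarrow> 'a set \<Rightarrow> bool" where
  "square_summable_on p S \<longleftrightarrow> (\<lambda>n. (cmod (p n))\<^sup>2) summable_on S"

definition square_norm_on :: "('a \<Rightarrow> complex) \<Rightarrow> 'a set \<Rightarrow> real" where
  "square_norm_on p S = (\<Sum>\<^sub>\<infinity>n\<in>S. (cmod (p n))\<^sup>2)"

text \<open>Bilinear, without complex conjugation: polynomials in the transversal operator are then
  symmetric for it, and conjugates are written explicitly where a norm is wanted
  (\<open>pairing_cnj\<close>).\<close>

definition pairing :: "'a set \<Rightarrow> ('a \<Rightarrow> complex) \<Rightarrow> ('a \<Rightarrow> complex) \<Rightarrow> complex" where
  "pairing S p q = (\<Sum>\<^sub>\<infinity>n\<in>S. p n * q n)"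

lemma square_norm_on_nonneg: "0 \<le> square_norm_on p S"
  by (simp add: square_norm_on_def infsum_nonneg)

lemma square_summable_on_bounded:
  assumes "\<And>F. finite F \<Longrightarrow> F \<subseteq> S \<Longrightarrow> (\<Sum>n\<in>F. (cmod (p n))\<^sup>2) \<le> B"
  shows "square_summable_on p S" "square_norm_on p S \<le> B"
proof -
  show *: "square_summable_on p S"
    unfolding square_summable_on_def
    by (rule nonneg_bdd_above_summable_on) (auto simp: bdd_above_def intro!: exI[of _ B] assms)
  show "square_norm_on p S \<le> B"
    using * unfolding square_summable_on_def square_norm_on_def
    by (intro infsum_le_finite_sums assms)
qed

lemma sum_le_square_norm_on:
  assumes "square_summable_on p S" "finite F" "F \<subseteq> S"
  shows "(\<Sum>n\<in>F. (cmod (p n))\<^sup>2) \<le> square_norm_on p S"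
  using assms unfolding square_summable_on_def square_norm_on_def
  by (intro finite_sum_le_infsum) auto

text \<open>The finite Cauchy-Schwarz inequality bounds all finite sums of
  \<open>norm (p n * q n)\<close> by the same constant, which yields absolute summability and the
  estimate at once.\<close>

lemma cauchy_schwarz_infsum:
  assumes "square_summable_on p S" "square_summable_on q S"
  shows "(\<lambda>n. p n * q n) summable_on S"
    and "cmod (pairing S p q) \<le> sqrt (square_norm_on p S * square_norm_on q S)"
proof -
  let ?B = "sqrt (square_norm_on p S * square_norm_on q S)"
  have fin: "(\<Sum>n\<in>F. norm (p n * q n)) \<le> ?B" if F: "finite F" "F \<subseteq> S" for F
  proof -
    have "(\<Sum>n\<in>F. cmod (p n) * cmod (q n))\<^sup>2 \<le> (\<Sum>n\<in>F. (cmod (p n))\<^sup>2) * (\<Sum>n\<in>F. (cmod (q n))\<^sup>2)"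
      by (rule Cauchy_Schwarz_ineq_sum)
    also have "\<dots> \<le> square_norm_on p S * square_norm_on q S"
      using F assms by (intro mult_mono sum_le_square_norm_on square_norm_on_nonneg sum_nonneg) auto
    finally show ?thesis
      by (simp add: norm_mult real_le_rsqrt)
  qed
  have abs: "(\<lambda>n. norm (p n * q n)) summable_on S"
    by (rule nonneg_bdd_above_summable_on) (auto simp: bdd_above_def intro!: exI[of _ ?B] fin)
  show "(\<lambda>n. p n * q n) summable_on S"
    by (rule abs_summable_summable[OF abs])
  have "cmod (pairing S p q) \<le> (\<Sum>\<^sub>\<infinity>n\<in>S. norm (p n * q n))"
    unfolding pairing_def by (rule norm_infsum_bound[OF abs])
  also have "\<dots> \<le> ?B"
    by (rule infsum_le_finite_sums[OF abs fin])
  finally show "cmod (pairing S p q) \<le> ?B" .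
qed

lemma square_summable_on_cmult:
  assumes "square_summable_on p S"
  shows "square_summable_on (\<lambda>n. c * p n) S"
  using assms unfolding square_summable_on_def
  by (simp add: norm_mult power_mult_distrib summable_on_cmult_right)

lemma norm_add_square_le: "(cmod (x + y))\<^sup>2 \<le> 2 * (cmod x)\<^sup>2 + 2 * (cmod y)\<^sup>2"
proof -
  have "(cmod (x + y))\<^sup>2 \<le> (cmod x + cmod y)\<^sup>2"
    by (simp add: norm_triangle_ineq power_mono)
  also have "\<dots> \<le> 2 * (cmod x)\<^sup>2 + 2 * (cmod y)\<^sup>2"
    using zero_le_power2[of "cmod x - cmod y"] by (simp add: power2_eq_square algebra_simps)
  finally show ?thesis .
qed

lemma square_summable_on_add:
  assumes "square_summable_on p S" "square_summable_on q S"
  shows "square_summable_on (\<lambda>n. p n + q n) S"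
    and "square_norm_on (\<lambda>n. p n + q n) S \<le> 2 * square_norm_on p S + 2 * square_norm_on q S"
proof -
  have "(\<Sum>n\<in>F. (cmod (p n + q n))\<^sup>2) \<le> 2 * square_norm_on p S + 2 * square_norm_on q S"
    if F: "finite F" "F \<subseteq> S" for F
  proof -
    have "(\<Sum>n\<in>F. (cmod (p n + q n))\<^sup>2) \<le> (\<Sum>n\<in>F. 2 * (cmod (p n))\<^sup>2 + 2 * (cmod (q n))\<^sup>2)"
      by (intro sum_mono norm_add_square_le)
    also have "\<dots> = 2 * (\<Sum>n\<in>F. (cmod (p n))\<^sup>2) + 2 * (\<Sum>n\<in>F. (cmod (q n))\<^sup>2)"
      by (simp add: sum.distrib sum_distrib_left)
    also have "\<dots> \<le> 2 * square_norm_on p S + 2 * square_norm_on q S"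
      using sum_le_square_norm_on[OF assms(1) F] sum_le_square_norm_on[OF assms(2) F] by simp
    finally show ?thesis .
  qed
  from square_summable_on_bounded[OF this]
  show "square_summable_on (\<lambda>n. p n + q n) S"
    and "square_norm_on (\<lambda>n. p n + q n) S \<le> 2 * square_norm_on p S + 2 * square_norm_on q S"
    by auto
qed

lemma square_summable_on_diff:
  assumes "square_summable_on p S" "square_summable_on q S"
  shows "square_summable_on (\<lambda>n. p n - q n) S"
  using square_summable_on_add(1)[OF assms(1) square_summable_on_cmult[OF assms(2), of "-1"]]
  by simp

lemma square_summable_on_sum:
  assumes "\<And>j. j \<in> J \<Longrightarrow> square_summable_on (p j) S"
  shows "square_summable_on (\<lambda>n. \<Sum>j\<in>J. p j n) S"
  using assms
  by (induction J rule: infinite_finite_induct)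
     (auto intro: square_summable_on_add simp: square_summable_on_def[of "\<lambda>n. 0"])

lemma square_summable_on_subset:
  "square_summable_on p S \<Longrightarrow> A \<subseteq> S \<Longrightarrow> square_summable_on p A"
  unfolding square_summable_on_def using summable_on_subset_banach by blast

lemma pairing_cong:
  "(\<And>n. n \<in> S \<Longrightarrow> p n = p' n) \<Longrightarrow> (\<And>n. n \<in> S \<Longrightarrow> q n = q' n) \<Longrightarrow> pairing S p q = pairing S p' q'"
  unfolding pairing_def by (intro infsum_cong) simp

lemma pairing_add_left:
  assumes "square_summable_on p S" "square_summable_on p' S" "square_summable_on q S"
  shows "pairing S (\<lambda>n. p n + p' n) q = pairing S p q + pairing S p' q"
  unfolding pairing_def
  using infsum_add[OF cauchy_schwarz_infsum(1)[OF assms(1,3)] cauchy_schwarz_infsum(1)[OF assms(2,3)]]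
  by (simp add: ring_distribs)

lemma pairing_cmult_left: "pairing S (\<lambda>n. c * p n) q = c * pairing S p q"
  unfolding pairing_def by (simp add: mult.assoc infsum_cmult_right')

lemma pairing_diff_left:
  assumes "square_summable_on p S" "square_summable_on p' S" "square_summable_on q S"
  shows "pairing S (\<lambda>n. p n - p' n) q = pairing S p q - pairing S p' q"
  using pairing_add_left[OF assms(1) square_summable_on_cmult[OF assms(2), of "-1"] assms(3)]
    pairing_cmult_left[of S "-1" p' q] by simp

lemma pairing_commute: "pairing S p q = pairing S q p"
  unfolding pairing_def by (simp add: mult.commute)

lemma pairing_sum_left:
  assumes "\<And>j. j \<in> J \<Longrightarrow> square_summable_on (p j) S" "square_summable_on q S"
  shows "pairing S (\<lambda>n. \<Sum>j\<in>J. p j n) q = (\<Sum>j\<in>J. pairing S (p j) q)"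
  using assms(1)
proof (induction J rule: infinite_finite_induct)
  case (insert x J)
  then show ?case
    using assms(2) by (simp add: pairing_add_left square_summable_on_sum)
qed (simp_all add: pairing_def)

lemma pairing_cnj:
  assumes "square_summable_on p S"
  shows "pairing S p (\<lambda>n. cnj (p n)) = of_real (square_norm_on p S)"
proof -
  have "pairing S p (\<lambda>n. cnj (p n)) = (\<Sum>\<^sub>\<infinity>n\<in>S. complex_of_real ((cmod (p n))\<^sup>2))"
    unfolding pairing_def by (intro infsum_cong) (simp add: complex_norm_square del: of_real_power)
  also have "\<dots> = of_real (square_norm_on p S)"
    using assms unfolding square_norm_on_def square_summable_on_def
    by (intro infsumI has_sum_of_real has_sum_infsum)
  finally show ?thesis .
qed

section \<open>The transversal operator and its polynomials\<close>

text \<open>Functions stay defined on the whole lattice and only the set of summation is cut down,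
  so that no separate lattice of dimension \<open>d - 1\<close> has to be introduced.\<close>

definition slice :: "'d \<Rightarrow> int \<Rightarrow> (int ^ 'd) set" where
  "slice i k = {n. n $ i = k}"

definition shift :: "int ^ 'd \<Rightarrow> (int ^ 'd \<Rightarrow> complex) \<Rightarrow> int ^ 'd \<Rightarrow> complex" where
  "shift a u n = u (n + a)"

lemma slice_eq_iff:
  assumes "m \<in> slice i k" "n \<in> slice i k"
  shows "m = n \<longleftrightarrow> (\<forall>j\<in>UNIV - {i}. m $ j = n $ j)"
proof
  assume *: "\<forall>j\<in>UNIV - {i}. m $ j = n $ j"
  have "m $ j = n $ j" for j
    using * assms by (cases "j = i") (auto simp: slice_def)
  then show "m = n" by (simp add: vec_eq_iff)
qed simp

lemma bij_betw_slice_translate: "a $ i = l - k \<Longrightarrow> bij_betw (\<lambda>n. n + a) (slice i k) (slice i l)"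
  by (rule bij_betwI[where g = "\<lambda>n. n - a"]) (auto simp: slice_def)

lemma square_summable_on_shift:
  assumes "a $ i = l - k"
  shows "square_summable_on (shift a u) (slice i k) \<longleftrightarrow> square_summable_on u (slice i l)"
    and "square_norm_on (shift a u) (slice i k) = square_norm_on u (slice i l)"
  using summable_on_reindex_bij_betw[OF bij_betw_slice_translate[OF assms], of "\<lambda>n. (cmod (u n))\<^sup>2"]
    infsum_reindex_bij_betw[OF bij_betw_slice_translate[OF assms], of "\<lambda>n. (cmod (u n))\<^sup>2"]
  by (simp_all add: square_summable_on_def square_norm_on_def shift_def)

lemma pairing_shift:
  assumes "a $ i = 0"
  shows "pairing (slice i k) (shift a p) q = pairing (slice i k) p (shift (- a) q)"
  using infsum_reindex_bij_betw[OF bij_betw_slice_translate, of a i k k "\<lambda>n. p n * q (n - a)"] assms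
  by (simp add: pairing_def shift_def)

text \<open>In partial Fourier variables transverse to \<open>e\<^sub>i\<close> this is multiplication by
  \<open>\<mu> - 2 \<Sum>\<^bsub>j \<noteq> i\<^esub> cos x\<^sub>j\<close>; with \<open>\<mu> = 2d - 4E\<close> the equation \<open>(\<Delta> + E) u = 0\<close> reads
  \<open>u (n + e\<^sub>i) + u (n - e\<^sub>i) = transversal_op i \<mu> u n\<close>.\<close>

definition transversal_op :: "'d \<Rightarrow> real \<Rightarrow> (int ^ 'd \<Rightarrow> complex) \<Rightarrow> int ^ 'd \<Rightarrow> complex" where
  "transversal_op i \<mu> u n =
     of_real \<mu> * u n - (\<Sum>j\<in>UNIV - {i}. shift (axis j 1) u n + shift (- axis j 1) u n)"

text \<open>Horner's scheme for the polynomial \<open>p\<close> evaluated at the operator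
  \<open>transversal_op i \<mu>\<close>.\<close>

definition poly_op :: "'d \<Rightarrow> real \<Rightarrow> real poly \<Rightarrow> (int ^ 'd \<Rightarrow> complex) \<Rightarrow> int ^ 'd \<Rightarrow> complex" where
  "poly_op i \<mu> p = fold_coeffs (\<lambda>a F u n. of_real a * u n + transversal_op i \<mu> (F u) n) p (\<lambda>u n. 0)"

lemma transversal_op_zero [simp]: "transversal_op i \<mu> (\<lambda>n. 0) = (\<lambda>n. 0)"
  by (simp add: transversal_op_def shift_def fun_eq_iff)

lemma transversal_op_add:
  "transversal_op i \<mu> (\<lambda>n. u n + v n) = (\<lambda>n. transversal_op i \<mu> u n + transversal_op i \<mu> v n)"
  by (simp add: transversal_op_def shift_def sum.distrib algebra_simps fun_eq_iff)

lemma transversal_op_cmult: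
  "transversal_op i \<mu> (\<lambda>n. c * u n) = (\<lambda>n. c * transversal_op i \<mu> u n)"
  by (simp add: transversal_op_def shift_def sum.distrib sum_distrib_left algebra_simps fun_eq_iff)

lemma transversal_op_diff:
  "transversal_op i \<mu> (\<lambda>n. u n - v n) = (\<lambda>n. transversal_op i \<mu> u n - transversal_op i \<mu> v n)"
  using transversal_op_add[of i \<mu> u "\<lambda>n. -1 * v n"] transversal_op_cmult[of i \<mu> "-1" v] by simp

lemma transversal_op_shift:
  "transversal_op i \<mu> (shift a u) = shift a (transversal_op i \<mu> u)"
  by (simp add: transversal_op_def shift_def algebra_simps fun_eq_iff)

lemma transversal_op_cnj:
  "transversal_op i \<mu> (\<lambda>n. cnj (u n)) = (\<lambda>n. cnj (transversal_op i \<mu> u n))"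
  by (simp add: transversal_op_def shift_def fun_eq_iff)

lemma poly_op_0 [simp]: "poly_op i \<mu> 0 u = (\<lambda>n. 0)"
  by (simp add: poly_op_def)

lemma poly_op_pCons:
  "poly_op i \<mu> (pCons a p) u = (\<lambda>n. of_real a * u n + transversal_op i \<mu> (poly_op i \<mu> p u) n)"
  by (cases "a = 0 \<and> p = 0") (auto simp: poly_op_def)

lemma poly_op_add_arg:
  "poly_op i \<mu> p (\<lambda>n. u n + v n) = (\<lambda>n. poly_op i \<mu> p u n + poly_op i \<mu> p v n)"
  by (induction p) (simp_all add: poly_op_pCons transversal_op_add algebra_simps)

lemma poly_op_cmult_arg:
  "poly_op i \<mu> p (\<lambda>n. c * u n) = (\<lambda>n. c * poly_op i \<mu> p u n)"
  by (induction p) (simp_all add: poly_op_pCons transversal_op_cmult algebra_simps)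

lemma poly_op_diff_arg:
  "poly_op i \<mu> p (\<lambda>n. u n - v n) = (\<lambda>n. poly_op i \<mu> p u n - poly_op i \<mu> p v n)"
  using poly_op_add_arg[of i \<mu> p u "\<lambda>n. -1 * v n"] poly_op_cmult_arg[of i \<mu> p "-1" v] by simp

lemma poly_op_cnj: "poly_op i \<mu> p (\<lambda>n. cnj (u n)) = (\<lambda>n. cnj (poly_op i \<mu> p u n))"
  by (induction p) (simp_all add: poly_op_pCons transversal_op_cnj)

lemma poly_op_add: "poly_op i \<mu> (p + q) u = (\<lambda>n. poly_op i \<mu> p u n + poly_op i \<mu> q u n)"
  by (induction p q rule: poly_induct2)
     (simp_all add: poly_op_pCons transversal_op_add algebra_simps)

lemma poly_op_smult: "poly_op i \<mu> (smult a p) u = (\<lambda>n. of_real a * poly_op i \<mu> p u n)"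
  by (induction p) (simp_all add: poly_op_pCons transversal_op_cmult algebra_simps)

lemma poly_op_diff: "poly_op i \<mu> (p - q) u = (\<lambda>n. poly_op i \<mu> p u n - poly_op i \<mu> q u n)"
  using poly_op_add[of i \<mu> p "smult (-1) q" u] poly_op_smult[of i \<mu> "-1" q u] by simp

text \<open>With linearity this makes \<open>poly_op i \<mu>\<close> a homomorphism of algebras. All
  these operators therefore commute, and polynomial identities turn into operator
  identities.\<close>

lemma poly_op_mult: "poly_op i \<mu> (p * q) u = poly_op i \<mu> p (poly_op i \<mu> q u)"
  by (induction p) (simp_all add: poly_op_pCons poly_op_add poly_op_smult mult_pCons_left)

lemma poly_op_const: "poly_op i \<mu> [:a:] u = (\<lambda>n. of_real a * u n)"
  by (simp add: poly_op_pCons)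

lemma poly_op_X: "poly_op i \<mu> [:0, 1:] u = transversal_op i \<mu> u"
  by (simp add: poly_op_pCons)

lemma transversal_op_cong:
  assumes "\<And>m. m \<in> slice i k \<Longrightarrow> u m = v m" "n \<in> slice i k"
  shows "transversal_op i \<mu> u n = transversal_op i \<mu> v n"
  using assms unfolding transversal_op_def shift_def
  by (intro arg_cong2[where f = minus] sum.cong arg_cong2[where f = plus] arg_cong2[where f = times])
     (auto simp: slice_def axis_def)

text \<open>Only translations along \<open>e\<^sub>j\<close> with \<open>j \<noteq> i\<close> occur,
  and they preserve every slice. Identities known on a single slice may thus be inserted under the
  operator.\<close>

lemma poly_op_cong:
  assumes "\<And>m. m \<in> slice i k \<Longrightarrow> u m = v m" "n \<in> slice i k"
  shows "poly_op i \<mu> p u n = poly_op i \<mu> p v n"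
  using assms(2)
proof (induction p arbitrary: n)
  case (pCons a p)
  then show ?case
    using assms(1) by (auto simp: poly_op_pCons intro: transversal_op_cong)
qed simp

lemma square_summable_transversal_op:
  assumes "square_summable_on u (slice i k)"
  shows "square_summable_on (transversal_op i \<mu> u) (slice i k)"
proof -
  have "square_summable_on (\<lambda>n. of_real \<mu> * u n - (\<Sum>j\<in>UNIV - {i}. shift (axis j 1) u n + shift (- axis j 1) u n)) (slice i k)"
    using assms square_summable_on_shift(1)[of _ i k k u]
    by (intro square_summable_on_diff square_summable_on_sum square_summable_on_add square_summable_on_cmult)
       (auto simp: axis_def)
  then show ?thesis
    by (simp add: transversal_op_def[abs_def])
qed

lemma square_summable_poly_op:
  assumes "square_summable_on u (slice i k)"
  shows "square_summable_on (poly_op i \<mu> p u) (slice i k)"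
proof (induction p)
  case 0
  then show ?case by (simp add: square_summable_on_def)
next
  case (pCons a p)
  then show ?case
    using assms unfolding poly_op_pCons
    by (intro square_summable_on_add square_summable_transversal_op square_summable_on_cmult)
qed

text \<open>Translations by \<open>axis j 1\<close> and by \<open>- axis j 1\<close> are transposes
  of each other and enter the operator with the same coefficient.\<close>

lemma pairing_transversal_op:
  assumes "square_summable_on u (slice i k)" "square_summable_on v (slice i k)"
  shows "pairing (slice i k) (transversal_op i \<mu> u) v = pairing (slice i k) u (transversal_op i \<mu> v)"
proof -
  define S where "S = slice i k"
  have sh: "square_summable_on (shift (axis j 1) w) S" "square_summable_on (shift (- axis j 1) w) S"
    if "j \<in> UNIV - {i}" "square_summable_on w S" for j w
    using that square_summable_on_shift(1)[of _ i k k w] by (auto simp: axis_def S_def)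
  have expand: "pairing S (transversal_op i \<mu> w) z = of_real \<mu> * pairing S w z -
      (\<Sum>j\<in>UNIV - {i}. pairing S (shift (axis j 1) w) z + pairing S (shift (- axis j 1) w) z)"
    if w: "square_summable_on w S" and z: "square_summable_on z S" for w z
  proof -
    have sum: "square_summable_on (\<lambda>n. shift (axis j 1) w n + shift (- axis j 1) w n) S" if "j \<in> UNIV - {i}" for j
      using sh[OF that w] by (rule square_summable_on_add)
    have "pairing S (transversal_op i \<mu> w) z = pairing S (\<lambda>n. of_real \<mu> * w n) z -
        pairing S (\<lambda>n. \<Sum>j\<in>UNIV - {i}. shift (axis j 1) w n + shift (- axis j 1) w n) z"
      unfolding transversal_op_def[abs_def]
      by (intro pairing_diff_left square_summable_on_cmult square_summable_on_sum sum w z)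
    also have "pairing S (\<lambda>n. \<Sum>j\<in>UNIV - {i}. shift (axis j 1) w n + shift (- axis j 1) w n) z =
        (\<Sum>j\<in>UNIV - {i}. pairing S (shift (axis j 1) w) z + pairing S (shift (- axis j 1) w) z)"
      using sh[OF _ w] by (subst pairing_sum_left[OF sum z]) (auto intro!: sum.cong pairing_add_left z)
    finally show ?thesis
      by (simp add: pairing_cmult_left)
  qed
  have "pairing S (shift (axis j 1) u) v + pairing S (shift (- axis j 1) u) v =
        pairing S (shift (axis j 1) v) u + pairing S (shift (- axis j 1) v) u" if "j \<in> UNIV - {i}" for j
    using that pairing_shift[of "axis j 1" i k u v] pairing_shift[of "- axis j 1" i k u v]
    by (auto simp: S_def axis_def pairing_commute)
  then have "pairing S (transversal_op i \<mu> u) v = pairing S (transversal_op i \<mu> v) u"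
    using assms by (simp add: expand S_def[symmetric] pairing_commute[of S u v])
  then show ?thesis
    by (simp add: S_def pairing_commute)
qed

lemma pairing_poly_op:
  assumes "square_summable_on u (slice i k)" "square_summable_on v (slice i k)"
  shows "pairing (slice i k) (poly_op i \<mu> p u) v = pairing (slice i k) u (poly_op i \<mu> p v)"
  using assms(2)
proof (induction p arbitrary: v)
  case 0
  then show ?case by (simp add: pairing_def)
next
  case (pCons a p)
  \<comment> \<open>Moving the outermost factor across first leaves \<open>poly_op i \<mu> p\<close>
    acting on \<open>transversal_op i \<mu> v\<close>, whereas the Horner form has the two factors
    in the other order. The induction is over arbitrary \<open>v\<close> for the same
    reason.\<close>
  have comm: "poly_op i \<mu> p (transversal_op i \<mu> v) = transversal_op i \<mu> (poly_op i \<mu> p v)"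
    using poly_op_mult[of i \<mu> p "[:0,1:]" v] poly_op_mult[of i \<mu> "[:0,1:]" p v]
    by (auto simp: fun_eq_iff poly_op_X mult.commute)
  have "pairing (slice i k) (poly_op i \<mu> (pCons a p) u) v =
      of_real a * pairing (slice i k) u v +
      pairing (slice i k) (transversal_op i \<mu> (poly_op i \<mu> p u)) v"
    unfolding poly_op_pCons using assms(1) pCons.prems
    by (subst pairing_add_left)
       (auto simp: pairing_cmult_left intro!: square_summable_on_cmult square_summable_transversal_op
          square_summable_poly_op)
  also have "pairing (slice i k) (transversal_op i \<mu> (poly_op i \<mu> p u)) v =
      pairing (slice i k) u (transversal_op i \<mu> (poly_op i \<mu> p v))"
    using assms(1) pCons
    by (simp add: pairing_transversal_op square_summable_poly_op square_summable_transversal_op comm)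
  also have "of_real a * pairing (slice i k) u v + pairing (slice i k) u (transversal_op i \<mu> (poly_op i \<mu> p v)) =
      of_real a * pairing (slice i k) v u + pairing (slice i k) (transversal_op i \<mu> (poly_op i \<mu> p v)) u"
    by (simp add: pairing_commute)
  also have "\<dots> = pairing (slice i k) (poly_op i \<mu> (pCons a p) v) u"
    unfolding poly_op_pCons using assms(1) pCons.prems
    by (subst pairing_add_left)
       (auto simp: pairing_cmult_left intro!: square_summable_on_cmult square_summable_transversal_op
          square_summable_poly_op)
  finally show ?case
    by (simp add: pairing_commute)
qed

section \<open>Chebyshev polynomials\<close>

text \<open>Normalised so that \<open>2 cos x\<close> is sent to \<open>2 cos (k x)\<close>. This is
  why the constant is 2 and the recursion carries no factor 2.\<close>

fun chebyshev_T :: "nat \<Rightarrow> real poly" where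
  "chebyshev_T 0 = [:2:]"
| "chebyshev_T (Suc 0) = [:0, 1:]"
| "chebyshev_T (Suc (Suc k)) = [:0, 1:] * chebyshev_T (Suc k) - chebyshev_T k"

text \<open>\<open>2 cos x\<close> is sent to \<open>sin (k x) / sin x\<close>; the index is one
  higher than in the usual numbering of the second kind, so that the family starts with 0.\<close>

fun chebyshev_U :: "nat \<Rightarrow> real poly" where
  "chebyshev_U 0 = 0"
| "chebyshev_U (Suc 0) = 1"
| "chebyshev_U (Suc (Suc k)) = [:0, 1:] * chebyshev_U (Suc k) - chebyshev_U k"

lemma poly_chebyshev_T: "poly (chebyshev_T k) (2 * cos x) = 2 * cos (real k * x)"
proof (induction k rule: chebyshev_T.induct)
  case (3 k)
  have "cos (real (Suc (Suc k)) * x) + cos (real k * x) = 2 * cos x * cos (real (Suc k) * x)"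
    using cos_add[of "real (Suc k) * x" x] cos_diff[of "real (Suc k) * x" x]
    by (simp add: algebra_simps)
  with 3 show ?case by (simp add: algebra_simps)
qed auto

lemma poly_chebyshev_U: "sin x * poly (chebyshev_U k) (2 * cos x) = sin (real k * x)"
proof (induction k rule: chebyshev_U.induct)
  case (3 k)
  have "sin (real (Suc (Suc k)) * x) + sin (real k * x) = 2 * cos x * sin (real (Suc k) * x)"
    using sin_add[of "real (Suc k) * x" x] sin_diff[of "real (Suc k) * x" x]
    by (simp add: algebra_simps)
  moreover have "sin x * poly (chebyshev_U (Suc (Suc k))) (2 * cos x) =
      2 * cos x * (sin x * poly (chebyshev_U (Suc k)) (2 * cos x)) - sin x * poly (chebyshev_U k) (2 * cos x)"
    by (simp add: algebra_simps)
  ultimately show ?case using 3 by simp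
qed auto

text \<open>Write \<open>y = 2 cos x\<close>. Staying away from the endpoints -2 and 2 keeps
  \<open>sin x\<close> at least \<open>sqrt (1 - r\<^sup>2)\<close>. What matters is that neither
  bound depends on \<open>k\<close>.\<close>

lemma abs_poly_chebyshev_le:
  fixes y r :: real
  assumes y: "\<bar>y\<bar> \<le> 2 * r" and r: "r < 1"
  shows "\<bar>poly (chebyshev_T k) y\<bar> \<le> 2" "\<bar>poly (chebyshev_U k) y\<bar> \<le> 1 / sqrt (1 - r\<^sup>2)"
proof -
  define x where "x = arccos (y / 2)"
  have x: "y = 2 * cos x" "sin x = sqrt (1 - (y / 2)\<^sup>2)"
    using y r by (auto simp: x_def cos_arccos_abs sin_arccos_abs)
  show "\<bar>poly (chebyshev_T k) y\<bar> \<le> 2"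
    by (simp add: x(1) poly_chebyshev_T abs_mult)
  have "r \<ge> 0" using y by linarith
  then have r2: "r\<^sup>2 < 1" using r by (simp add: power_less_one_iff abs_square_less_1)
  have "(y / 2)\<^sup>2 \<le> r\<^sup>2" using y \<open>r \<ge> 0\<close> by (intro power2_le_iff_abs_le[THEN iffD2]) auto
  then have s: "sqrt (1 - r\<^sup>2) \<le> sin x" by (simp add: x(2))
  have pos: "0 < sqrt (1 - r\<^sup>2)" using r2 by simp
  have "sqrt (1 - r\<^sup>2) * \<bar>poly (chebyshev_U k) y\<bar> \<le> sin x * \<bar>poly (chebyshev_U k) y\<bar>"
    using s by (intro mult_right_mono) auto
  also have "\<dots> = \<bar>sin x * poly (chebyshev_U k) y\<bar>"
    using less_le_trans[OF pos s] by (simp add: abs_mult)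
  also have "\<dots> \<le> 1"
    using poly_chebyshev_U[of x k] by (simp add: x(1))
  finally show "\<bar>poly (chebyshev_U k) y\<bar> \<le> 1 / sqrt (1 - r\<^sup>2)"
    using pos by (simp add: field_simps)
qed

section \<open>Fourier coefficients on the transversal torus\<close>

text \<open>The integral of \<open>(cmod (g x - p x))\<^sup>2\<close> is nonnegative, where
  \<open>p\<close> is the orthogonal projection of \<open>g\<close> onto the span of the conjugates
  of the \<open>e m\<close>; expanding the square gives the claim.\<close>

lemma (in prob_space) bessel_inequality:
  fixes e :: "'b \<Rightarrow> 'a \<Rightarrow> complex" and g :: "'a \<Rightarrow> complex"
  assumes e: "\<And>m. m \<in> F \<Longrightarrow> e m \<in> borel_measurable M" "\<And>m x. m \<in> F \<Longrightarrow> norm (e m x) \<le> 1"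
    and orth: "\<And>m n. m \<in> F \<Longrightarrow> n \<in> F \<Longrightarrow> (\<integral>x. e m x * cnj (e n x) \<partial>M) = (if m = n then 1 else 0)"
    and g: "g \<in> borel_measurable M" "\<And>x. norm (g x) \<le> B"
    and F: "finite F"
  shows "(\<Sum>m\<in>F. (cmod (\<integral>x. e m x * g x \<partial>M))\<^sup>2) \<le> B\<^sup>2"
proof -
  define c where "c m = (\<integral>x. e m x * g x \<partial>M)" for m
  \<comment> \<open>The coefficient \<open>c m\<close> pairs \<open>g\<close> with
    \<open>e m\<close> without conjugation, so it is the Hermitian coefficient of \<open>g\<close>
    along \<open>cnj (e m)\<close>.\<close>
  define p where "p x = (\<Sum>m\<in>F. c m * cnj (e m x))" for x
  define s where "s = (\<Sum>m\<in>F. (cmod (c m))\<^sup>2)"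
  note [measurable] = e(1) g(1)
  have cnj_meas: "(\<lambda>x. cnj (f x)) \<in> borel_measurable M" if "f \<in> borel_measurable M" for f
    using measurable_compose[OF that borel_measurable_continuous_onI[of cnj]] by (simp add: continuous_intros)
  have p_meas [measurable]: "p \<in> borel_measurable M"
    unfolding p_def using e(1) by (intro borel_measurable_sum borel_measurable_times cnj_meas) auto
  define D where "D = (\<Sum>m\<in>F. cmod (c m))"
  have p_le: "norm (p x) \<le> D" for x
    unfolding p_def D_def
    by (intro sum_norm_le) (use e(2) in \<open>auto simp: norm_mult intro!: mult_left_le\<close>)
  have int: "integrable M (\<lambda>x. f x * h x)"
    if "f \<in> borel_measurable M" "h \<in> borel_measurable M" "\<And>x. norm (f x) \<le> b" "\<And>x. norm (h x) \<le> b'"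
    for f h :: "'a \<Rightarrow> complex" and b b' :: real
    using that
    by (intro integrable_const_bound[where B = "b * b'"])
       (auto simp: norm_mult intro!: mult_mono order.trans[OF norm_ge_zero])
  have gp: "(\<integral>x. g x * cnj (p x) \<partial>M) = of_real s"
  proof -
    have "(\<integral>x. g x * cnj (p x) \<partial>M) = (\<integral>x. (\<Sum>m\<in>F. cnj (c m) * (e m x * g x)) \<partial>M)"
      by (intro Bochner_Integration.integral_cong) (simp_all add: p_def sum_distrib_left mult_ac)
    also have "\<dots> = (\<Sum>m\<in>F. cnj (c m) * c m)"
      by (subst Bochner_Integration.integral_sum)
         (auto simp: c_def intro!: integrable_mult_right int[OF e(1) g(1) e(2) g(2)])
    finally show ?thesis
      by (simp add: s_def complex_norm_square mult.commute del: of_real_power)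
  qed
  have pp: "(\<integral>x. p x * cnj (p x) \<partial>M) = of_real s"
  proof -
    have "(\<integral>x. p x * cnj (p x) \<partial>M) = (\<integral>x. (\<Sum>m\<in>F. \<Sum>n\<in>F. c m * cnj (c n) * (e n x * cnj (e m x))) \<partial>M)"
      by (intro Bochner_Integration.integral_cong) (simp_all add: p_def sum_product mult_ac)
    also have "\<dots> = (\<Sum>m\<in>F. \<Sum>n\<in>F. c m * cnj (c n) * (if n = m then 1 else 0))"
    proof -
      have i: "integrable M (\<lambda>x. c m * cnj (c n) * (e n x * cnj (e m x)))" if "m \<in> F" "n \<in> F" for m n
        using that e by (intro integrable_mult_right int[of _ _ 1 1] cnj_meas) auto
      show ?thesis
        using i orth by (simp add: Bochner_Integration.integral_sum Bochner_Integration.integrable_sum cong: sum.cong)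
    qed
    also have "\<dots> = (\<Sum>m\<in>F. c m * cnj (c m))"
      using F by (intro sum.cong) (auto simp: if_distrib[of "\<lambda>x. _ * x"] sum.delta' cong: if_cong)
    finally show ?thesis
      by (simp add: s_def complex_norm_square del: of_real_power)
  qed
  have pg: "(\<integral>x. p x * cnj (g x) \<partial>M) = of_real s"
  proof -
    have "(\<integral>x. p x * cnj (g x) \<partial>M) = (\<integral>x. cnj (g x * cnj (p x)) \<partial>M)"
      by (simp add: mult.commute del: Bochner_Integration.integral_cnj)
    also have "\<dots> = cnj (of_real s)"
      by (rule trans[OF Bochner_Integration.integral_cnj arg_cong[OF gp, of cnj]])
    finally show ?thesis by simp
  qed
  have gg: "integrable M (\<lambda>x. g x * cnj (g x))"
    by (rule int[OF g(1) cnj_meas[OF g(1)], of B B]) (simp_all add: g(2))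
  have i1: "integrable M (\<lambda>x. g x * cnj (p x))"
    by (rule int[OF g(1) cnj_meas[OF p_meas], of B D]) (simp_all add: g(2) p_le)
  have i2: "integrable M (\<lambda>x. p x * cnj (g x))"
    by (rule int[OF p_meas cnj_meas[OF g(1)], of D B]) (simp_all add: g(2) p_le)
  have i3: "integrable M (\<lambda>x. p x * cnj (p x))"
    by (rule int[OF p_meas cnj_meas[OF p_meas], of D D]) (simp_all add: p_le)
  have norm_int: "complex_of_real (\<integral>x. (cmod (f x))\<^sup>2 \<partial>M) = (\<integral>x. f x * cnj (f x) \<partial>M)" for f
    by (rule trans[OF integral_complex_of_real[symmetric]])
       (intro Bochner_Integration.integral_cong refl complex_norm_square)
  have "(\<integral>x. (g x - p x) * cnj (g x - p x) \<partial>M) =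
      (\<integral>x. g x * cnj (g x) - g x * cnj (p x) - p x * cnj (g x) + p x * cnj (p x) \<partial>M)"
    by (intro Bochner_Integration.integral_cong refl) (simp add: algebra_simps)
  also have "\<dots> = (\<integral>x. g x * cnj (g x) \<partial>M) - of_real s - of_real s + of_real s"
    unfolding Bochner_Integration.integral_add[OF Bochner_Integration.integrable_diff[OF Bochner_Integration.integrable_diff[OF gg i1] i2] i3]
      Bochner_Integration.integral_diff[OF Bochner_Integration.integrable_diff[OF gg i1] i2]
      Bochner_Integration.integral_diff[OF gg i1] gp pg pp ..
  finally have "complex_of_real (\<integral>x. (cmod (g x - p x))\<^sup>2 \<partial>M) = of_real ((\<integral>x. (cmod (g x))\<^sup>2 \<partial>M) - s)"
    by (simp add: norm_int del: complex_cnj_diff)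
  then have "(\<integral>x. (cmod (g x - p x))\<^sup>2 \<partial>M) = (\<integral>x. (cmod (g x))\<^sup>2 \<partial>M) - s"
    by (simp only: of_real_eq_iff)
  moreover have "(\<integral>x. (cmod (g x - p x))\<^sup>2 \<partial>M) \<ge> 0" by simp
  ultimately have "s \<le> (\<integral>x. (cmod (g x))\<^sup>2 \<partial>M)" by linarith
  also have "\<dots> \<le> (\<integral>x. B\<^sup>2 \<partial>M)"
    using g by (intro integral_mono integrable_const_bound[where B = "B\<^sup>2"])
      (auto simp: power_mono)
  also have "\<dots> = B\<^sup>2" by (simp add: prob_space)
  finally show ?thesis by (simp add: s_def c_def)
qed

text \<open>The base point \<open>a\<close> is arbitrary, so that an arc around any given point fits into one period.\<close>

definition circle_measure :: "real \<Rightarrow> real measure" where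
  "circle_measure a = density lborel (\<lambda>x. ennreal (indicator {a..a + 2 * pi} x / (2 * pi)))"

lemma sets_circle_measure [simp, measurable_cong]: "sets (circle_measure a) = sets borel"
  by (simp add: circle_measure_def)

lemma prob_space_circle_measure: "prob_space (circle_measure a)"
proof
  have "emeasure (circle_measure a) (space (circle_measure a)) =
      (\<integral>\<^sup>+x. ennreal (1 / (2 * pi)) * indicator {a..a + 2 * pi} x \<partial>lborel)"
    unfolding circle_measure_def
    by (subst emeasure_density) (auto intro!: nn_integral_cong split: split_indicator)
  also have "\<dots> = 1"
    by (subst nn_integral_cmult_indicator) (auto simp: ennreal_mult[symmetric])
  finally show "emeasure (circle_measure a) (space (circle_measure a)) = 1" .
qed

text \<open>Fourier coefficients of the indicator of \<open>{- r..r}\<close> with respect to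
  normalised arc length; \<open>r / pi\<close> is the limit of the sine quotient at
  \<open>k = 0\<close>.\<close>

definition arc_weight :: "real \<Rightarrow> int \<Rightarrow> real" where
  "arc_weight r k = (if k = 0 then r / pi else sin (real_of_int k * r) / (pi * real_of_int k))"

text \<open>Since the arc lies inside the chosen period, the density is the constant
  \<open>1 / (2 * pi)\<close> on it, and an explicit antiderivative finishes the
  computation.\<close>

lemma integral_cis_arc:
  assumes "0 \<le> r" "a \<le> s - r" "s + r \<le> a + 2 * pi"
  shows "(\<integral>x. cis (of_int k * x) * indicator {s - r..s + r} x \<partial>circle_measure a) =
         of_real (arc_weight r k) * cis (of_int k * s)"
proof -
  have "(\<integral>x. cis (of_int k * x) * indicator {s - r..s + r} x \<partial>circle_measure a) =
      (\<integral>x. (indicator {a..a + 2 * pi} x / (2 * pi)) *\<^sub>R (cis (of_int k * x) * indicator {s - r..s + r} x) \<partial>lborel)"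
    unfolding circle_measure_def
    by (subst integral_density) (auto simp: cis_conv_exp)
  also have "\<dots> = (\<integral>x. of_real (1 / (2 * pi)) * (indicator {s - r..s + r} x *\<^sub>R cis (of_int k * x)) \<partial>lborel)"
    using assms
    by (intro Bochner_Integration.integral_cong) (auto split: split_indicator simp: scaleR_conv_of_real)
  also have "\<dots> = of_real (1 / (2 * pi)) * (\<integral>x. indicator {s - r..s + r} x *\<^sub>R cis (of_int k * x) \<partial>lborel)"
    by (rule integral_mult_right_zero)
  also have "(\<integral>x. indicator {s - r..s + r} x *\<^sub>R cis (of_int k * x) \<partial>lborel) =
      of_real (2 * pi * arc_weight r k) * cis (of_int k * s)"
  proof (cases "k = 0")
    case True
    have "(\<integral>x. indicator {s - r..s + r} x *\<^sub>R (1::complex) \<partial>lborel) = of_real (s + r) - of_real (s - r)"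
      using assms(1)
      by (intro integral_FTC_atLeastAtMost) (auto intro!: derivative_eq_intros)
    then show ?thesis using True by (simp add: arc_weight_def)
  next
    case False
    define F where "F x = cis (of_int k * x) / (\<i> * of_int k)" for x :: real
    have "(\<integral>x. indicator {s - r..s + r} x *\<^sub>R cis (of_int k * x) \<partial>lborel) = F (s + r) - F (s - r)"
    proof (rule integral_FTC_atLeastAtMost)
      show "(F has_vector_derivative cis (of_int k * x)) (at x within {s - r..s + r})" for x
      proof -
        have "((\<lambda>z. exp (\<i> * (of_int k * z)) / (\<i> * of_int k)) has_field_derivative
            exp (\<i> * (of_int k * of_real x))) (at (of_real x))"
          using False by (auto intro!: derivative_eq_intros simp: mult.commute[of _ \<i>])
        from has_vector_derivative_real_field[OF this] show ?thesis
          by (simp add: F_def[abs_def] cis_conv_exp)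
      qed
      show "continuous_on {s - r..s + r} (\<lambda>x. cis (of_int k * x))"
        by (intro continuous_intros)
    qed (use assms in auto)
    also have "F (s + r) - F (s - r) = cis (of_int k * s) * (cis (of_int k * r) - cis (- (of_int k * r))) / (\<i> * of_int k)"
      by (simp add: F_def cis_mult right_diff_distrib distrib_left diff_divide_distrib)
    also have "cis (of_int k * r) - cis (- (of_int k * r)) = 2 * \<i> * of_real (sin (of_int k * r))"
      by (simp add: complex_eq_iff)
    finally show ?thesis using False by (simp add: arc_weight_def)
  qed
  finally show ?thesis by simp
qed

text \<open>The full period is the arc of half-width \<open>pi\<close> about \<open>a + pi\<close>,
  and \<open>sin (k * pi)\<close> vanishes for integers \<open>k\<close>.\<close>

lemma integral_cis_circle:
  "(\<integral>x. cis (of_int k * x) \<partial>circle_measure a) = (if k = 0 then 1 else 0)"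
proof -
  have "(\<integral>x. cis (of_int k * x) \<partial>circle_measure a) =
      (\<integral>x. (indicator {a..a + 2 * pi} x / (2 * pi)) *\<^sub>R cis (of_int k * x) \<partial>lborel)"
    unfolding circle_measure_def
    by (subst integral_density) (auto simp: cis_conv_exp)
  also have "\<dots> = (\<integral>x. (indicator {a..a + 2 * pi} x / (2 * pi)) *\<^sub>R
      (cis (of_int k * x) * indicator {(a + pi) - pi..(a + pi) + pi} x) \<partial>lborel)"
    by (intro Bochner_Integration.integral_cong) (auto split: split_indicator)
  also have "\<dots> = (\<integral>x. cis (of_int k * x) * indicator {(a + pi) - pi..(a + pi) + pi} x \<partial>circle_measure a)"
    unfolding circle_measure_def
    by (subst integral_density) (auto simp: cis_conv_exp)
  also have "\<dots> = of_real (arc_weight pi k) * cis (of_int k * (a + pi))"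
    by (rule integral_cis_arc) auto
  also have "\<dots> = (if k = 0 then 1 else 0)"
    by (simp add: arc_weight_def mult.commute)
  finally show ?thesis .
qed

section \<open>Characters, Fourier coefficients and the multiplier of the transversal
  operator\<close>

definition character :: "'d set \<Rightarrow> int ^ 'd \<Rightarrow> ('d \<Rightarrow> real) \<Rightarrow> complex" where
  "character I m x = (\<Prod>j\<in>I. cis (of_int (m $ j) * x j))"

abbreviation torus :: "'d \<Rightarrow> real \<Rightarrow> ('d \<Rightarrow> real) measure" where
  "torus i a \<equiv> Pi\<^sub>M (UNIV - {i}) (\<lambda>_. circle_measure a)"

definition fourier_coeff :: "'d \<Rightarrow> real \<Rightarrow> (('d \<Rightarrow> real) \<Rightarrow> complex) \<Rightarrow> int ^ 'd \<Rightarrow> complex" where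
  "fourier_coeff i a g m = (\<integral>x. character (UNIV - {i}) m x * g x \<partial>torus i a)"

definition symbol :: "'d \<Rightarrow> real \<Rightarrow> ('d \<Rightarrow> real) \<Rightarrow> real" where
  "symbol i \<mu> x = \<mu> - 2 * (\<Sum>j\<in>UNIV - {i}. cos (x j))"

lemma norm_character [simp]: "norm (character I m x) = 1"
  by (simp add: character_def prod_norm[symmetric])

lemma character_add_axis:
  assumes "finite I" "j \<in> I"
  shows "character I (m + axis j c) x = character I m x * cis (of_int c * x j)"
proof -
  have "character I (m + axis j c) x = (\<Prod>k\<in>I. cis (of_int (m $ k) * x k) * (if k = j then cis (of_int c * x k) else 1))"
    unfolding character_def by (intro prod.cong) (auto simp: axis_def cis_mult distrib_right)
  also have "\<dots> = character I m x * cis (of_int c * x j)"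
    using assms by (simp add: prod.distrib character_def)
  finally show ?thesis .
qed

lemma measurable_torus_component: "j \<noteq> i \<Longrightarrow> (\<lambda>x. x j) \<in> borel_measurable (torus i a)"
  using measurable_component_singleton[of j "UNIV - {i}" "\<lambda>_. circle_measure a"]
  by (simp cong: measurable_cong_sets)

lemma measurable_cis: "cis \<in> borel_measurable borel"
  by (rule borel_measurable_continuous_onI[OF continuous_on_cis[OF continuous_on_id]])

lemma measurable_character: "character (UNIV - {i}) m \<in> borel_measurable (torus i a)"
proof -
  have "(\<lambda>x. cis (of_int (m $ j) * x j)) \<in> borel_measurable (torus i a)" if "j \<in> UNIV - {i}" for j
  proof (rule measurable_compose[OF _ measurable_cis])
    show "(\<lambda>x. of_int (m $ j) * x j) \<in> borel_measurable (torus i a)"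
      using that by (intro borel_measurable_times borel_measurable_const measurable_torus_component) auto
  qed
  then show ?thesis
    unfolding character_def[abs_def] by (rule borel_measurable_prod)
qed

lemma measurable_symbol: "symbol i \<mu> \<in> borel_measurable (torus i a)"
proof -
  have cos: "(cos :: real \<Rightarrow> real) \<in> borel_measurable borel"
    by (rule borel_measurable_continuous_onI[OF continuous_on_cos[OF continuous_on_id]])
  have "(\<lambda>x. cos (x j)) \<in> borel_measurable (torus i a)" if "j \<in> UNIV - {i}" for j
    by (rule measurable_compose[OF measurable_torus_component cos]) (use that in auto)
  then show ?thesis
    unfolding symbol_def[abs_def]
    by (intro borel_measurable_diff borel_measurable_times borel_measurable_const borel_measurable_sum)
qed

lemma prob_space_torus: "prob_space (torus i a)"
  by (intro prob_space_PiM prob_space_circle_measure)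

text \<open>The integral factors over the coordinates. The restriction to one slice matters: the
  characters ignore coordinate \<open>i\<close>, so they only separate points that share it.\<close>

lemma character_orthonormal:
  assumes "m \<in> slice i k" "n \<in> slice i k"
  shows "(\<integral>x. character (UNIV - {i}) m x * cnj (character (UNIV - {i}) n x) \<partial>torus i a) = (if m = n then 1 else 0)"
proof -
  interpret circle: prob_space "circle_measure a" by (rule prob_space_circle_measure)
  interpret product_prob_space "\<lambda>_::'a. circle_measure a" "UNIV - {i}" ..
  have "(\<integral>x. character (UNIV - {i}) m x * cnj (character (UNIV - {i}) n x) \<partial>torus i a) =
      (\<integral>x. (\<Prod>j\<in>UNIV - {i}. cis (of_int (m $ j - n $ j) * x j)) \<partial>torus i a)"
    by (intro Bochner_Integration.integral_cong)
       (simp_all add: character_def cis_cnj cis_mult prod.distrib[symmetric] left_diff_distrib)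
  also have "\<dots> = (\<Prod>j\<in>UNIV - {i}. \<integral>x. cis (of_int (m $ j - n $ j) * x) \<partial>circle_measure a)"
  proof (rule product_integral_prod)
    show "integrable (circle_measure a) (\<lambda>x. cis (of_int (m $ j - n $ j) * x))" for j
      by (rule circle.integrable_const_bound[where B = 1])
         (auto intro!: borel_measurable_continuous_onI continuous_intros cong: measurable_cong_sets)
  qed simp
  also have "\<dots> = (\<Prod>j\<in>UNIV - {i}. if m $ j - n $ j = 0 then 1 else 0)"
    by (simp only: integral_cis_circle)
  also have "\<dots> = (if \<forall>j\<in>UNIV - {i}. m $ j = n $ j then 1 else 0)"
    by auto
  also have "(\<forall>j\<in>UNIV - {i}. m $ j = n $ j) \<longleftrightarrow> m = n"
    using slice_eq_iff[OF assms] by simp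
  finally show ?thesis .
qed

definition bounded_measurable :: "'d::finite \<Rightarrow> real \<Rightarrow> (('d \<Rightarrow> real) \<Rightarrow> complex) \<Rightarrow> bool" where
  "bounded_measurable i a g \<longleftrightarrow> g \<in> borel_measurable (torus i a) \<and> (\<exists>B. \<forall>x. norm (g x) \<le> B)"

text \<open>Bessel's inequality on finite subsets of the slice. It turns a uniform bound on a
  function of the frequencies into a uniform bound on its coefficients.\<close>

lemma square_summable_fourier_coeff:
  assumes "g \<in> borel_measurable (torus i a)" "\<And>x. norm (g x) \<le> B"
  shows "square_summable_on (fourier_coeff i a g) (slice i k)"
    and "square_norm_on (fourier_coeff i a g) (slice i k) \<le> B\<^sup>2"
proof -
  interpret prob_space "torus i a" by (rule prob_space_torus)
  have "(\<Sum>m\<in>F. (cmod (fourier_coeff i a g m))\<^sup>2) \<le> B\<^sup>2" if "finite F" "F \<subseteq> slice i k" for F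
    unfolding fourier_coeff_def using assms that
    by (intro bessel_inequality) (auto simp: character_orthonormal[of _ _ k] subset_iff measurable_character)
  from square_summable_on_bounded[OF this]
  show "square_summable_on (fourier_coeff i a g) (slice i k)"
    and "square_norm_on (fourier_coeff i a g) (slice i k) \<le> B\<^sup>2"
    by auto
qed

lemma integrable_character_times:
  assumes "bounded_measurable i a g"
  shows "integrable (torus i a) (\<lambda>x. character (UNIV - {i}) m x * g x)"
proof -
  interpret prob_space "torus i a" by (rule prob_space_torus)
  obtain B where "\<And>x. norm (g x) \<le> B" using assms by (auto simp: bounded_measurable_def)
  then show ?thesis
    using assms
    by (intro integrable_const_bound[where B = B] borel_measurable_times measurable_character)
       (auto simp: norm_mult bounded_measurable_def)
qed

lemma abs_symbol_le: "\<bar>symbol i \<mu> (x :: 'd::finite \<Rightarrow> real)\<bar> \<le> \<bar>\<mu>\<bar> + 2 * real CARD('d)"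
proof -
  have "\<bar>\<Sum>j\<in>UNIV - {i}. cos (x j)\<bar> \<le> real (card (UNIV - {i}))"
    using sum_norm_bound[of "UNIV - {i}" "\<lambda>j. cos (x j)" 1] by simp
  also have "\<dots> \<le> real CARD('d)"
    by (simp add: card_mono)
  finally show ?thesis unfolding symbol_def by simp
qed

lemma bounded_measurable_symbol_times:
  assumes "bounded_measurable i a g"
  shows "bounded_measurable i a (\<lambda>x. of_real (symbol i \<mu> x) * g x)"
proof -
  obtain B where "\<And>x. norm (g x) \<le> B" using assms by (auto simp: bounded_measurable_def)
  then have "norm (of_real (symbol i \<mu> x) * g x) \<le> (\<bar>\<mu>\<bar> + 2 * real CARD('a)) * B" for x
    using abs_symbol_le[of i \<mu> x] by (auto simp: norm_mult intro!: mult_mono)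
  then show ?thesis
    using assms measurable_symbol[of i \<mu> a] unfolding bounded_measurable_def
    by (auto intro!: borel_measurable_times borel_measurable_of_real)
qed

lemma bounded_measurable_add:
  assumes "bounded_measurable i a g" "bounded_measurable i a h"
  shows "bounded_measurable i a (\<lambda>x. g x + h x)"
  using assms unfolding bounded_measurable_def
  by (auto intro!: borel_measurable_add) (meson add_mono norm_triangle_le)

lemma bounded_measurable_cmult:
  assumes "bounded_measurable i a g"
  shows "bounded_measurable i a (\<lambda>x. c * g x)"
  using assms unfolding bounded_measurable_def
  by (auto intro!: borel_measurable_times simp: norm_mult) (meson mult_left_mono norm_ge_zero)

lemma bounded_measurable_poly_symbol_times:
  assumes "bounded_measurable i a g"
  shows "bounded_measurable i a (\<lambda>x. of_real (poly p (symbol i \<mu> x)) * g x)"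
proof (induction p)
  case 0
  then show ?case by (auto simp: bounded_measurable_def intro: exI[of _ 0])
next
  case (pCons b p)
  have "(\<lambda>x. of_real (poly (pCons b p) (symbol i \<mu> x)) * g x) =
      (\<lambda>x. of_real b * g x + of_real (symbol i \<mu> x) * (of_real (poly p (symbol i \<mu> x)) * g x))"
    by (simp add: fun_eq_iff algebra_simps)
  then show ?case
    using assms pCons
    by (auto intro!: bounded_measurable_add bounded_measurable_cmult bounded_measurable_symbol_times)
qed

text \<open>Translating the index by \<open>axis j 1\<close> or \<open>axis j (-1)\<close>
  multiplies the character by \<open>cis (x j)\<close> or \<open>cis (- x j)\<close>, and the two
  factors add up to \<open>2 cos (x j)\<close>.\<close>

lemma transversal_op_fourier_coeff:
  assumes "bounded_measurable i a g"
  shows "transversal_op i \<mu> (fourier_coeff i a g) = fourier_coeff i a (\<lambda>x. of_real (symbol i \<mu> x) * g x)"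
proof
  fix m
  let ?e = "character (UNIV - {i})"
  note int = integrable_character_times[OF assms]
  have minus: "- axis j 1 = (axis j (-1) :: int ^ 'a)" for j by (simp add: vec_eq_iff axis_def)
  have "transversal_op i \<mu> (fourier_coeff i a g) m =
      (\<integral>x. of_real \<mu> * (?e m x * g x) - (\<Sum>j\<in>UNIV - {i}. ?e (m + axis j 1) x * g x + ?e (m + axis j (-1)) x * g x) \<partial>torus i a)"
  proof -
    have pair: "integrable (torus i a) (\<lambda>x. ?e (m + axis j 1) x * g x + ?e (m + axis j (-1)) x * g x)" for j
      by (intro Bochner_Integration.integrable_add int)
    have "(\<integral>x. of_real \<mu> * (?e m x * g x) - (\<Sum>j\<in>UNIV - {i}. ?e (m + axis j 1) x * g x + ?e (m + axis j (-1)) x * g x) \<partial>torus i a)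
        = (\<integral>x. of_real \<mu> * (?e m x * g x) \<partial>torus i a) -
          (\<integral>x. (\<Sum>j\<in>UNIV - {i}. ?e (m + axis j 1) x * g x + ?e (m + axis j (-1)) x * g x) \<partial>torus i a)"
      by (intro Bochner_Integration.integral_diff integrable_mult_right int Bochner_Integration.integrable_sum pair)
    also have "(\<integral>x. (\<Sum>j\<in>UNIV - {i}. ?e (m + axis j 1) x * g x + ?e (m + axis j (-1)) x * g x) \<partial>torus i a) =
        (\<Sum>j\<in>UNIV - {i}. fourier_coeff i a g (m + axis j 1) + fourier_coeff i a g (m + axis j (-1)))"
      by (subst Bochner_Integration.integral_sum[OF pair])
         (simp add: Bochner_Integration.integral_add[OF int int] fourier_coeff_def)
    finally show ?thesis
      by (simp add: transversal_op_def shift_def fourier_coeff_def minus)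
  qed
  also have "\<dots> = fourier_coeff i a (\<lambda>x. of_real (symbol i \<mu> x) * g x) m"
    unfolding fourier_coeff_def
  proof (intro Bochner_Integration.integral_cong refl)
    fix x
    have "?e (m + axis j 1) x * g x + ?e (m + axis j (-1)) x * g x = of_real (2 * cos (x j)) * (?e m x * g x)"
      if "j \<in> UNIV - {i}" for j
    proof -
      have "cis (x j) + cis (- x j) = of_real (2 * cos (x j))" by (simp add: complex_eq_iff)
      then show ?thesis using that by (simp add: character_add_axis distrib_left[symmetric] distrib_right[symmetric] mult_ac)
    qed
    then have "(\<Sum>j\<in>UNIV - {i}. ?e (m + axis j 1) x * g x + ?e (m + axis j (-1)) x * g x) =
        of_real (2 * (\<Sum>j\<in>UNIV - {i}. cos (x j))) * (?e m x * g x)"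
      by (subst sum.cong[OF refl]) (assumption, simp add: sum_distrib_left sum_distrib_right)
    then show "of_real \<mu> * (?e m x * g x) - (\<Sum>j\<in>UNIV - {i}. ?e (m + axis j 1) x * g x + ?e (m + axis j (-1)) x * g x) =
        ?e m x * (of_real (symbol i \<mu> x) * g x)"
      by (simp add: symbol_def algebra_simps)
  qed
  finally show "transversal_op i \<mu> (fourier_coeff i a g) m = fourier_coeff i a (\<lambda>x. of_real (symbol i \<mu> x) * g x) m" .
qed

text \<open>This is the only passage between operators and frequencies. It is applied to test
  functions only; the solution \<open>u\<close> itself is never Fourier transformed.\<close>

lemma poly_op_fourier_coeff:
  assumes "bounded_measurable i a g"
  shows "poly_op i \<mu> p (fourier_coeff i a g) = fourier_coeff i a (\<lambda>x. of_real (poly p (symbol i \<mu> x)) * g x)"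
proof (induction p)
  case 0
  then show ?case by (simp add: fourier_coeff_def fun_eq_iff)
next
  case (pCons b p)
  let ?h = "\<lambda>x. of_real (poly p (symbol i \<mu> x)) * g x"
  have bm: "bounded_measurable i a ?h" by (rule bounded_measurable_poly_symbol_times[OF assms])
  show ?case
  proof
    fix m
    have "poly_op i \<mu> (pCons b p) (fourier_coeff i a g) m =
        of_real b * fourier_coeff i a g m + fourier_coeff i a (\<lambda>x. of_real (symbol i \<mu> x) * ?h x) m"
      by (simp add: poly_op_pCons pCons transversal_op_fourier_coeff[OF bm])
    also have "\<dots> = (\<integral>x. of_real b * (character (UNIV - {i}) m x * g x) +
        character (UNIV - {i}) m x * (of_real (symbol i \<mu> x) * ?h x) \<partial>torus i a)"
      unfolding fourier_coeff_def
      using assms bm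
      by (subst Bochner_Integration.integral_add)
         (auto intro!: integrable_mult_right integrable_character_times bounded_measurable_symbol_times)
    also have "\<dots> = fourier_coeff i a (\<lambda>x. of_real (poly (pCons b p) (symbol i \<mu> x)) * g x) m"
      unfolding fourier_coeff_def
      by (intro Bochner_Integration.integral_cong) (simp_all add: algebra_simps)
    finally show "poly_op i \<mu> (pCons b p) (fourier_coeff i a g) m =
        fourier_coeff i a (\<lambda>x. of_real (poly (pCons b p) (symbol i \<mu> x)) * g x) m" .
  qed
qed

section \<open>Indicators of boxes of arcs: test functions localised in frequency\<close>

definition arc_box :: "'d::finite \<Rightarrow> ('d \<Rightarrow> real) \<Rightarrow> real \<Rightarrow> ('d \<Rightarrow> real) \<Rightarrow> complex" where
  "arc_box i s r x = (\<Prod>j\<in>UNIV - {i}. indicator {s j - r..s j + r} (x j))"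

lemma norm_arc_box_le: "norm (arc_box i s r x) \<le> 1"
  unfolding arc_box_def prod_norm[symmetric] by (intro prod_le_1) (auto split: split_indicator)

lemma arc_box_nonzero:
  assumes "arc_box i s r x \<noteq> 0" "j \<noteq> i"
  shows "\<bar>x j - s j\<bar> \<le> r"
proof -
  have "indicator {s j - r..s j + r} (x j) \<noteq> (0 :: complex)"
    using assms unfolding arc_box_def by (subst (asm) prod_zero_iff) auto
  then show ?thesis by (simp add: indicator_eq_0_iff abs_le_iff)
qed

lemma measurable_arc_box: "arc_box i s r \<in> borel_measurable (torus i a)"
  unfolding arc_box_def[abs_def]
  by (intro borel_measurable_prod measurable_compose[OF measurable_torus_component borel_measurable_indicator]) auto

lemma bounded_measurable_arc_box: "bounded_measurable i a (arc_box i s r)"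
  using norm_arc_box_le[of i s r] measurable_arc_box[of i s r a] by (auto simp: bounded_measurable_def)

text \<open>The centre \<open>s\<close> enters through the character alone. Pairing with a finitely
  supported function hence gives a trigonometric polynomial in \<open>s\<close>.\<close>

lemma fourier_coeff_arc_box:
  assumes "0 \<le> r" "\<And>j. j \<noteq> i \<Longrightarrow> a \<le> s j - r" "\<And>j. j \<noteq> i \<Longrightarrow> s j + r \<le> a + 2 * pi"
  shows "fourier_coeff i a (arc_box i s r) m =
    of_real (\<Prod>j\<in>UNIV - {i}. arc_weight r (m $ j)) * character (UNIV - {i}) m s"
proof -
  interpret circle: prob_space "circle_measure a" by (rule prob_space_circle_measure)
  interpret product_prob_space "\<lambda>_::'a. circle_measure a" "UNIV - {i}" ..
  have "fourier_coeff i a (arc_box i s r) m =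
      (\<integral>x. (\<Prod>j\<in>UNIV - {i}. cis (of_int (m $ j) * x j) * indicator {s j - r..s j + r} (x j)) \<partial>torus i a)"
    by (simp add: fourier_coeff_def character_def arc_box_def prod.distrib)
  also have "\<dots> = (\<Prod>j\<in>UNIV - {i}. \<integral>x. cis (of_int (m $ j) * x) * indicator {s j - r..s j + r} x \<partial>circle_measure a)"
  proof (rule product_integral_prod)
    show "integrable (circle_measure a) (\<lambda>x. cis (of_int (m $ j) * x) * indicator {s j - r..s j + r} x)" for j
    proof (rule circle.integrable_const_bound[where B = 1])
      show "(\<lambda>x. cis (of_int (m $ j) * x) * indicator {s j - r..s j + r} x) \<in> borel_measurable (circle_measure a)"
        using measurable_compose[OF _ measurable_cis, of "\<lambda>x. of_int (m $ j) * x" borel] by measurable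
    qed (auto simp: norm_mult split: split_indicator)
  qed simp
  also have "\<dots> = (\<Prod>j\<in>UNIV - {i}. of_real (arc_weight r (m $ j)) * cis (of_int (m $ j) * s j))"
    using assms by (intro prod.cong integral_cis_arc) auto
  finally show ?thesis
    by (simp add: prod.distrib character_def)
qed

text \<open>A sufficiently short arc has no vanishing coefficient on a given finite set of indices,
  so the weights can be divided out later.\<close>

lemma arc_weight_nonzero:
  assumes "0 < r" "\<bar>of_int k\<bar> * r < pi"
  shows "arc_weight r k \<noteq> 0"
proof (cases "k = 0")
  case False
  have "sin (\<bar>of_int k\<bar> * r) > 0"
    using assms False by (intro sin_gt_zero) auto
  then have "sin (of_int k * r) \<noteq> 0"
    by (cases "k > 0") auto
  then show ?thesis using False by (simp add: arc_weight_def)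
qed (use assms in \<open>simp add: arc_weight_def\<close>)

section \<open>Trigonometric polynomials and uniqueness\<close>

text \<open>Multiplication by a power of \<open>cis x\<close> produces an ordinary polynomial in
  \<open>cis x\<close>, which has infinitely many roots.\<close>

lemma trig_poly_eq_0:
  fixes c :: "int \<Rightarrow> complex"
  assumes "finite K" "infinite S" "inj_on cis S"
    and zero: "\<And>x. x \<in> S \<Longrightarrow> (\<Sum>k\<in>K. c k * cis (of_int k * x)) = 0"
    and "k \<in> K"
  shows "c k = 0"
proof -
  \<comment> \<open>A shift large enough to make every exponent \<open>k + N\<close>
    nonnegative.\<close>
  define N where "N = (\<Sum>k\<in>K. \<bar>k\<bar>)"
  have N: "0 \<le> k + N" if "k \<in> K" for k
    using member_le_sum[of k K abs] that assms(1) by (auto simp: N_def)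
  define p where "p = (\<Sum>k\<in>K. monom (c k) (nat (k + N)))"
  have "poly p (cis x) = 0" if "x \<in> S" for x
  proof -
    have "cis x ^ nat (k + N) = cis (of_int N * x) * cis (of_int k * x)" if "k \<in> K" for k
    proof -
      have "cis x ^ nat (k + N) = cis (real (nat (k + N)) * x)" by (rule Complex.DeMoivre)
      also have "real (nat (k + N)) = of_int N + of_int k" using N[OF that] by simp
      finally show ?thesis by (simp add: cis_mult distrib_right)
    qed
    then have "poly p (cis x) = cis (of_int N * x) * (\<Sum>k\<in>K. c k * cis (of_int k * x))"
      by (simp add: p_def poly_sum poly_monom sum_distrib_left mult_ac)
    then show ?thesis using zero[OF that] by simp
  qed
  then have "cis ` S \<subseteq> {z. poly p z = 0}" by auto
  moreover have "infinite (cis ` S)" using assms(2,3) by (simp add: finite_image_iff)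
  ultimately have "p = 0" using poly_roots_finite finite_subset by blast
  have "coeff p (nat (k + N)) = (\<Sum>l\<in>K. if l = k then c l else 0)"
    unfolding p_def coeff_sum
    using N \<open>k \<in> K\<close> by (intro sum.cong) (auto simp: nat_eq_iff)
  also have "\<dots> = c k" using assms(1) \<open>k \<in> K\<close> by simp
  finally show ?thesis using \<open>p = 0\<close> by simp
qed

text \<open>One variable is removed at a time by the univariate case, the others being frozen; this
  is why \<open>character\<close> takes an index set. Coefficients are recovered only up to
  summation over a fibre, because characters on \<open>I\<close> see no coordinate outside
  \<open>I\<close>.\<close>

lemma multivariate_trig_poly_eq_0:
  fixes b :: "int ^ 'd \<Rightarrow> complex"
  assumes "finite I" "infinite S" "inj_on cis S" "finite A"
    and "\<And>s. (\<And>j. j \<in> I \<Longrightarrow> s j \<in> S) \<Longrightarrow> (\<Sum>m\<in>A. b m * character I m s) = 0"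
    and "m\<^sub>0 \<in> A"
  shows "(\<Sum>m | m \<in> A \<and> (\<forall>j\<in>I. m $ j = m\<^sub>0 $ j). b m) = 0"
  using assms(1,4-6)
proof (induction I arbitrary: A rule: finite_induct)
  case empty
  then show ?case by (simp add: character_def)
next
  case (insert j I)
  define A' where "A' = {m \<in> A. m $ j = m\<^sub>0 $ j}"
  have "(\<Sum>m\<in>A'. b m * character I m s) = 0" if s: "\<And>l. l \<in> I \<Longrightarrow> s l \<in> S" for s
  proof -
    let ?c = "\<lambda>k. \<Sum>m | m \<in> A \<and> m $ j = k. b m * character I m s"
    have "(\<Sum>k\<in>(\<lambda>m. m $ j) ` A. ?c k * cis (of_int k * x)) = 0" if "x \<in> S" for x
    proof -
      have char: "character (insert j I) m (s(j := x)) = cis (of_int (m $ j) * x) * character I m s" for m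
        using insert.hyps by (auto simp: character_def intro!: prod.cong)
      have "(\<Sum>k\<in>(\<lambda>m. m $ j) ` A. ?c k * cis (of_int k * x)) =
          (\<Sum>k\<in>(\<lambda>m. m $ j) ` A. \<Sum>m | m \<in> A \<and> m $ j = k. b m * character (insert j I) m (s(j := x)))"
        by (intro sum.cong refl, unfold sum_distrib_right) (intro sum.cong refl, auto simp: char)
      also have "\<dots> = (\<Sum>m\<in>A. b m * character (insert j I) m (s(j := x)))"
        using insert.prems(1) by (intro sum.group) auto
      also have "\<dots> = 0"
        using s that insert.hyps by (intro insert.prems(2)) auto
      finally show ?thesis .
    qed
    from trig_poly_eq_0[OF _ assms(2,3) this, of "m\<^sub>0 $ j"] insert.prems show ?thesis
      by (auto simp: A'_def)
  qed
  from insert.IH[OF _ this] insert.prems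
  have "(\<Sum>m | m \<in> A' \<and> (\<forall>l\<in>I. m $ l = m\<^sub>0 $ l). b m) = 0"
    by (simp add: A'_def)
  also have "{m. m \<in> A' \<and> (\<forall>l\<in>I. m $ l = m\<^sub>0 $ l)} = {m. m \<in> A \<and> (\<forall>l\<in>insert j I. m $ l = m\<^sub>0 $ l)}"
    by (auto simp: A'_def)
  finally show ?case .
qed

lemma inj_on_cis_interval: "\<eta> \<le> 1 \<Longrightarrow> inj_on cis {t - \<eta> / 2..t + \<eta> / 2}"
proof (rule inj_onI)
  fix x y assume \<eta>: "\<eta> \<le> 1" and x: "x \<in> {t - \<eta> / 2..t + \<eta> / 2}" and y: "y \<in> {t - \<eta> / 2..t + \<eta> / 2}"
    and "cis x = cis y"
  then have "cis (x - y) = 1" by (simp add: cis_divide[symmetric])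
  then have "cos (x - y) = 1" by (simp add: complex_eq_iff)
  then obtain n :: int where n: "x - y = of_int n * (2 * pi)" using cos_one_2pi_int by auto
  have "\<bar>x - y\<bar> \<le> 1" using \<eta> x y by auto
  then have "\<bar>of_int n :: real\<bar> * (2 * pi) \<le> 1" using n by (simp add: abs_mult)
  moreover have "2 * pi > 1" using pi_gt3 by simp
  ultimately have "\<bar>of_int n :: real\<bar> < 1"
    by (smt (verit) mult_less_cancel_right2)
  then have "n = 0" by linarith
  then show "x = y" using n by simp
qed

text \<open>The energy condition \<open>0 < E < d\<close> enters here: it provides the point \<open>x\<^sub>j = t\<close> (all \<open>j\<close>) with
  \<open>cos t = 1 - 2 E / d\<close>, at which the symbol is \<open>2 cos t \<in> (-2, 2)\<close>. Near it the Chebyshev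
  polynomials of the symbol are bounded uniformly in their degree.\<close>

lemma symbol_bounded_near_point:
  fixes i :: "'d::finite"
  assumes "0 < E" "E < real CARD('d)" "\<mu> = 2 * real CARD('d) - 4 * E"
  obtains t \<eta> r where "0 < \<eta>" "\<eta> \<le> 1" "r < 1"
    "\<forall>x. (\<forall>j. j \<noteq> i \<longrightarrow> \<bar>x j - t\<bar> \<le> \<eta>) \<longrightarrow> \<bar>symbol i \<mu> x\<bar> \<le> 2 * r"
proof -
  define d where "d = real CARD('d)"
  define y where "y = 1 - 2 * E / d"
  define t where "t = arccos y"
  \<comment> \<open>\<open>2 * r\<close> is halfway between \<open>2 * \<bar>y\<bar>\<close> and 2.
    The choice of \<eta> allows the symbol to move by at most \<open>1 - \<bar>y\<bar>\<close> away
    from its value \<open>2 * y\<close> at the point.\<close>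
  define r where "r = (1 + \<bar>y\<bar>) / 2"
  define \<eta> where "\<eta> = min 1 ((1 - \<bar>y\<bar>) / (2 * d))"
  have d: "d > 0" by (simp add: d_def)
  have y: "\<bar>y\<bar> < 1" using assms d by (auto simp: y_def d_def[symmetric] field_simps abs_if)
  then have cos_t: "cos t = y" by (simp add: t_def cos_arccos_abs)
  have card: "real (card (UNIV - {i})) = d - 1"
    by (simp add: card_Diff_singleton d_def of_nat_diff Suc_leI)
  have base: "\<mu> - 2 * (d - 1) * y = 2 * y"
    using d by (simp add: assms(3) y_def d_def[symmetric] field_simps)
  have "\<bar>symbol i \<mu> x\<bar> \<le> 2 * r" if x: "\<And>j. j \<noteq> i \<Longrightarrow> \<bar>x j - t\<bar> \<le> \<eta>" for x
  proof -
    have cos_le: "\<bar>cos t - cos (x j)\<bar> \<le> \<eta>" if "j \<in> UNIV - {i}" for j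
    proof -
      have "\<bar>cos t - cos (x j)\<bar> = 2 * \<bar>sin ((t + x j) / 2)\<bar> * \<bar>sin ((x j - t) / 2)\<bar>"
        by (simp add: cos_diff_cos abs_mult)
      also have "\<dots> \<le> 2 * 1 * \<bar>(x j - t) / 2\<bar>"
        by (intro mult_mono abs_sin_x_le_abs_x) auto
      also have "\<dots> \<le> \<eta>" using x that by auto
      finally show ?thesis .
    qed
    have "symbol i \<mu> x - 2 * y = 2 * (\<Sum>j\<in>UNIV - {i}. cos t - cos (x j))"
    proof -
      have "(\<Sum>j\<in>UNIV - {i}. cos t - cos (x j)) = (d - 1) * y - (\<Sum>j\<in>UNIV - {i}. cos (x j))"
        by (simp only: sum_subtractf sum_constant card cos_t)
      then show ?thesis using base by (simp add: symbol_def algebra_simps)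
    qed
    moreover have "\<bar>\<Sum>j\<in>UNIV - {i}. cos t - cos (x j)\<bar> \<le> (d - 1) * \<eta>"
      using sum_norm_bound[of "UNIV - {i}" "\<lambda>j. cos t - cos (x j)" \<eta>] cos_le unfolding card by simp
    moreover have "(d - 1) * \<eta> \<le> d * ((1 - \<bar>y\<bar>) / (2 * d))"
      using d y card by (intro mult_mono) (auto simp: \<eta>_def)
    moreover have "d * ((1 - \<bar>y\<bar>) / (2 * d)) = (1 - \<bar>y\<bar>) / 2" using d by simp
    ultimately show ?thesis by (simp add: r_def)
  qed
  moreover have "0 < \<eta>" "\<eta> \<le> 1" "r < 1" using y d by (auto simp: \<eta>_def r_def)
  ultimately show thesis using that by blast
qed

text \<open>The test functions \<open>\<phi>\<close> that matter are the Fourier transforms of indicators of small boxes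
  around the point of the previous lemma.\<close>

lemma eq_0_if_annihilates_chebyshev_bounded:
  fixes i :: "'d::finite" and b :: "int ^ 'd \<Rightarrow> complex"
  assumes E: "0 < E" "E < real CARD('d)" "\<mu> = 2 * real CARD('d) - 4 * E"
    and fin: "finite {m \<in> slice i 0. b m \<noteq> 0}"
    and annihilates: "\<And>\<phi> B. (\<And>k. square_summable_on (poly_op i \<mu> (chebyshev_T k) \<phi>) (slice i 0) \<and>
           square_norm_on (poly_op i \<mu> (chebyshev_T k) \<phi>) (slice i 0) \<le> B \<and>
           square_summable_on (poly_op i \<mu> (chebyshev_U k) \<phi>) (slice i 0) \<and>
           square_norm_on (poly_op i \<mu> (chebyshev_U k) \<phi>) (slice i 0) \<le> B) \<Longrightarrow>
         pairing (slice i 0) b \<phi> = 0"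
    and m: "m \<in> slice i 0"
  shows "b m = 0"
proof (rule ccontr)
  assume "b m \<noteq> 0"
  obtain t \<eta> r where \<eta>: "0 < \<eta>" "\<eta> \<le> 1" and r: "r < 1"
    and symbol_le: "\<And>x. (\<And>j. j \<noteq> i \<Longrightarrow> \<bar>x j - t\<bar> \<le> \<eta>) \<Longrightarrow> \<bar>symbol i \<mu> x\<bar> \<le> 2 * r"
    using symbol_bounded_near_point[OF E, of i] by metis
  define A where "A = {m \<in> slice i 0. b m \<noteq> 0}"
  define N where "N = (\<Sum>m\<in>A. \<Sum>j\<in>UNIV. \<bar>m $ j\<bar>)"
  have finA: "finite A" using fin by (simp add: A_def)
  have N: "\<bar>m $ j\<bar> \<le> N" if "m \<in> A" for m j
  proof -
    have "\<bar>m $ j\<bar> \<le> (\<Sum>j\<in>UNIV. \<bar>m $ j\<bar>)" by (rule member_le_sum[where f = "\<lambda>j. \<bar>m $ j\<bar>"]) auto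
    also have "\<dots> \<le> N"
      unfolding N_def by (rule member_le_sum[where f = "\<lambda>m. \<Sum>j\<in>UNIV. \<bar>m $ j\<bar>", OF that]) (simp_all add: finA sum_nonneg)
    finally show ?thesis .
  qed
  have "N \<ge> 0" by (simp add: N_def sum_nonneg)
  \<comment> \<open>The first bound keeps a box centred within \<open>\<eta> / 2\<close> of
    \<open>t\<close> inside the region where the symbol is controlled; the second makes all arc
    weights on \<open>A\<close> nonzero.\<close>
  define \<rho> where "\<rho> = min (\<eta> / 2) (1 / (of_int N + 1))"
  have \<rho>: "0 < \<rho>" "\<rho> \<le> \<eta> / 2" using \<eta> \<open>N \<ge> 0\<close> by (auto simp: \<rho>_def)
  have weight: "arc_weight \<rho> (n $ j) \<noteq> 0" if "n \<in> A" for n j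
  proof (rule arc_weight_nonzero[OF \<rho>(1)])
    have "\<bar>of_int (n $ j)\<bar> * \<rho> \<le> of_int N * (1 / (of_int N + 1))"
      using N[OF that, of j] \<rho> \<open>N \<ge> 0\<close> by (intro mult_mono) (auto simp: \<rho>_def)
    also have "\<dots> \<le> 1" using \<open>N \<ge> 0\<close> by simp
    also have "1 < pi" using pi_gt3 by simp
    finally show "\<bar>of_int (n $ j)\<bar> * \<rho> < pi" .
  qed
  define w where "w n = (\<Prod>j\<in>UNIV - {i}. arc_weight \<rho> (n $ j))" for n :: "int ^ 'd"
  have zero: "(\<Sum>n\<in>A. (b n * of_real (w n)) * character (UNIV - {i}) n s) = 0"
    if s: "\<And>j. j \<in> UNIV - {i} \<Longrightarrow> s j \<in> {t - \<eta> / 2..t + \<eta> / 2}" for s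
  proof -
    \<comment> \<open>With base point \<open>t - pi\<close> the period is centred at
      \<open>t\<close>, so all arcs used here fit into it.\<close>
    define \<phi> where "\<phi> = fourier_coeff i (t - pi) (arc_box i s \<rho>)"
    have near: "\<bar>symbol i \<mu> x\<bar> \<le> 2 * r" if "arc_box i s \<rho> x \<noteq> 0" for x
    proof (rule symbol_le)
      fix j assume "j \<noteq> i"
      then show "\<bar>x j - t\<bar> \<le> \<eta>"
        using arc_box_nonzero[OF that, of j] s[of j] \<rho>(2) by (simp add: abs_le_iff)
    qed
    have P: "square_summable_on (poly_op i \<mu> p \<phi>) (slice i 0) \<and>
        square_norm_on (poly_op i \<mu> p \<phi>) (slice i 0) \<le> C\<^sup>2"
      if p: "\<And>y. \<bar>y\<bar> \<le> 2 * r \<Longrightarrow> \<bar>poly p y\<bar> \<le> C" and "0 \<le> C" for p C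
    proof -
      let ?g = "\<lambda>x. of_real (poly p (symbol i \<mu> x)) * arc_box i s \<rho> x"
      have "norm (?g x) \<le> C" for x
      proof (cases "arc_box i s \<rho> x = 0")
        case False
        then show ?thesis
          using mult_mono[OF p[OF near[OF False]] norm_arc_box_le[of i s \<rho> x]] \<open>0 \<le> C\<close> by (simp add: norm_mult)
      qed (simp add: \<open>0 \<le> C\<close>)
      moreover have "?g \<in> borel_measurable (torus i (t - pi))"
        using bounded_measurable_poly_symbol_times[OF bounded_measurable_arc_box]
        unfolding bounded_measurable_def by blast
      ultimately show ?thesis
        using square_summable_fourier_coeff[of ?g i "t - pi" C]
        by (simp add: \<phi>_def poly_op_fourier_coeff[OF bounded_measurable_arc_box])
    qed
    \<comment> \<open>One constant that dominates both Chebyshev families at every degree.\<close>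
    define C where "C = max 2 (1 / sqrt (1 - r\<^sup>2))"
    have "pairing (slice i 0) b \<phi> = 0"
    proof (rule annihilates[where B = "C\<^sup>2"])
      fix k
      show "square_summable_on (poly_op i \<mu> (chebyshev_T k) \<phi>) (slice i 0) \<and>
           square_norm_on (poly_op i \<mu> (chebyshev_T k) \<phi>) (slice i 0) \<le> C\<^sup>2 \<and>
           square_summable_on (poly_op i \<mu> (chebyshev_U k) \<phi>) (slice i 0) \<and>
           square_norm_on (poly_op i \<mu> (chebyshev_U k) \<phi>) (slice i 0) \<le> C\<^sup>2"
      proof -
        have "0 \<le> C" by (simp add: C_def)
        moreover have "\<bar>poly (chebyshev_T k) y\<bar> \<le> C" "\<bar>poly (chebyshev_U k) y\<bar> \<le> C" if "\<bar>y\<bar> \<le> 2 * r" for y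
          using abs_poly_chebyshev_le[OF that r, of k] by (simp_all add: C_def)
        ultimately show ?thesis using P by blast
      qed
    qed
    also have "pairing (slice i 0) b \<phi> = (\<Sum>\<^sub>\<infinity>n\<in>A. b n * \<phi> n)"
      unfolding pairing_def by (rule infsum_cong_neutral) (auto simp: A_def)
    also have "\<dots> = (\<Sum>n\<in>A. b n * \<phi> n)" using finA by (rule infsum_finite)
    also have "\<dots> = (\<Sum>n\<in>A. (b n * of_real (w n)) * character (UNIV - {i}) n s)"
    proof (intro sum.cong refl)
      fix n
      have "\<phi> n = of_real (w n) * character (UNIV - {i}) n s"
        unfolding \<phi>_def w_def
      proof (rule fourier_coeff_arc_box)
        fix j assume "j \<noteq> i"
        then show "t - pi \<le> s j - \<rho>" "s j + \<rho> \<le> t - pi + 2 * pi"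
          using s[of j] \<rho>(2) \<eta> pi_gt3 by auto
      qed (use \<rho> in auto)
      then show "b n * \<phi> n = (b n * of_real (w n)) * character (UNIV - {i}) n s" by simp
    qed
    finally show ?thesis by simp
  qed
  have inf: "infinite {t - \<eta> / 2..t + \<eta> / 2}" using \<eta> by (simp add: infinite_Icc_iff)
  have "m \<in> A" using m \<open>b m \<noteq> 0\<close> by (simp add: A_def)
  have "(\<Sum>n | n \<in> A \<and> (\<forall>j\<in>UNIV - {i}. n $ j = m $ j). b n * of_real (w n)) = 0"
    by (rule multivariate_trig_poly_eq_0[OF _ inf inj_on_cis_interval[OF \<eta>(2)] finA zero \<open>m \<in> A\<close>]) auto
  \<comment> \<open>All of \<open>A\<close> lies in one slice, so the fibre sum reduces to the
    single coefficient at \<open>m\<close>.\<close>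
  also have "{n. n \<in> A \<and> (\<forall>j\<in>UNIV - {i}. n $ j = m $ j)} = {m}"
    using slice_eq_iff[OF _ m] \<open>m \<in> A\<close> by (auto simp: A_def)
  finally show False
    using \<open>b m \<noteq> 0\<close> weight[OF \<open>m \<in> A\<close>] by (simp add: w_def)
qed

section \<open>The Rellich type theorem\<close>

text \<open>A finite set \<open>F\<close> carries the total sum up to \<open>\<epsilon> / 2\<close>,
  and slices far out do not meet \<open>F\<close>.\<close>

lemma square_norm_slice_small:
  assumes "square_summable_on u UNIV" "\<epsilon> > 0"
  obtains R :: int where "\<And>k. \<bar>k\<bar> \<ge> R \<Longrightarrow> square_norm_on u (slice i k) < \<epsilon>"
proof -
  let ?f = "\<lambda>n. (cmod (u n))\<^sup>2"
  have summable: "?f summable_on UNIV" using assms(1) by (simp add: square_summable_on_def)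
  then have "(sum ?f \<longlongrightarrow> infsum ?f UNIV) (finite_subsets_at_top UNIV)"
    using has_sum_infsum has_sum_def by blast
  then have "eventually (\<lambda>F. dist (sum ?f F) (infsum ?f UNIV) < \<epsilon> / 2) (finite_subsets_at_top UNIV)"
    using assms(2) by (intro tendstoD) auto
  then obtain F where F: "finite F" "dist (sum ?f F) (infsum ?f UNIV) < \<epsilon> / 2"
    unfolding eventually_finite_subsets_at_top by blast
  define R where "R = (\<Sum>n\<in>F. \<bar>n $ i\<bar>) + 1"
  have R: "\<bar>n $ i\<bar> < R" if "n \<in> F" for n
    using member_le_sum[where f = "\<lambda>n. \<bar>n $ i\<bar>", OF that] F(1) by (simp add: R_def)
  have "square_norm_on u (slice i k) < \<epsilon>" if k: "\<bar>k\<bar> \<ge> R" for k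
  proof -
    have "(\<Sum>n\<in>G. ?f n) \<le> \<epsilon> / 2" if G: "finite G" "G \<subseteq> slice i k" for G
    proof -
      have "F \<inter> G = {}" using R G(2) k by (force simp: slice_def)
      then have "sum ?f F + sum ?f G = sum ?f (F \<union> G)"
        using F(1) G(1) by (simp add: sum.union_disjoint)
      also have "\<dots> \<le> infsum ?f UNIV"
        using F(1) G(1) by (intro finite_sum_le_infsum[OF summable]) auto
      finally show ?thesis using F(2) unfolding dist_real_def by linarith
    qed
    from square_summable_on_bounded(2)[of "slice i k" u "\<epsilon> / 2", OF this] show ?thesis using assms(2) by simp
  qed
  then show thesis by (rule that)
qed

text \<open>The sum telescopes: by the recursion for \<open>P\<close>, passing from \<open>K\<close>
  to \<open>K + 1\<close> changes the discrete Wronskian of \<open>P\<close> and \<open>v\<close> by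
  exactly \<open>P (Suc K)\<close> applied to \<open>F K\<close>.\<close>

lemma green_formula:
  assumes rec: "\<And>k. P (Suc (Suc k)) = [:0, 1:] * P (Suc k) - P k"
    and F: "\<And>k. F k = (\<lambda>n. v (Suc (Suc k)) n + v k n - transversal_op i \<mu> (v (Suc k)) n)"
  shows "(\<Sum>k<K. poly_op i \<mu> (P (Suc k)) (F k) n) =
    (poly_op i \<mu> (P K) (v (Suc K)) n - poly_op i \<mu> (P (Suc K)) (v K) n) -
    (poly_op i \<mu> (P 0) (v (Suc 0)) n - poly_op i \<mu> (P (Suc 0)) (v 0) n)"
proof (induction K)
  case (Suc K)
  have "poly_op i \<mu> ([:0, 1:] * P (Suc K)) (v (Suc K)) = poly_op i \<mu> (P (Suc K)) (transversal_op i \<mu> (v (Suc K)))"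
    using poly_op_mult[of i \<mu> "P (Suc K)" "[:0, 1:]"] by (simp add: poly_op_X mult.commute)
  then have "poly_op i \<mu> (P (Suc (Suc K))) (v (Suc K)) n =
      poly_op i \<mu> (P (Suc K)) (transversal_op i \<mu> (v (Suc K))) n - poly_op i \<mu> (P K) (v (Suc K)) n"
    by (simp only: rec poly_op_diff)
  moreover have "poly_op i \<mu> (P (Suc K)) (F K) n = poly_op i \<mu> (P (Suc K)) (v (Suc (Suc K))) n +
      poly_op i \<mu> (P (Suc K)) (v K) n - poly_op i \<mu> (P (Suc K)) (transversal_op i \<mu> (v (Suc K))) n"
    by (simp only: F poly_op_diff_arg poly_op_add_arg)
  ultimately show ?case using Suc by (simp del: poly_op_pCons)
qed simp

text \<open>Two solutions of the same second order recursion have a constant Wronskian. It serves as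
  the determinant when two relations are solved for one unknown.\<close>

lemma chebyshev_wronskian:
  "chebyshev_T k * chebyshev_U (Suc k) - chebyshev_U k * chebyshev_T (Suc k) = [:2:]"
proof (induction k)
  case 0
  then show ?case by simp
next
  case (Suc k)
  have "chebyshev_T (Suc k) * chebyshev_U (Suc (Suc k)) - chebyshev_U (Suc k) * chebyshev_T (Suc (Suc k)) =
      chebyshev_T k * chebyshev_U (Suc k) - chebyshev_U k * chebyshev_T (Suc k)"
    by (simp only: chebyshev_T.simps(3) chebyshev_U.simps(3)) (simp only: algebra_simps)
  with Suc show ?case by simp
qed

text \<open>The product formula for cosines in polynomial form. For \<open>j = 0\<close> it
  expresses the square of \<open>chebyshev_T k\<close> by \<open>chebyshev_T (2 * k)\<close> and a
  constant.\<close>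

lemma chebyshev_T_mult:
  "chebyshev_T k * chebyshev_T (k + j) = chebyshev_T (2 * k + j) + chebyshev_T j"
proof (induction k arbitrary: j rule: chebyshev_T.induct)
  case 1
  then show ?case by (simp add: algebra_simps numeral_poly flip: smult_add_left)
next
  case 2
  then show ?case by simp
next
  case (3 k)
  let ?X = "[:0, 1:] :: real poly"
  have "chebyshev_T (Suc (Suc k)) * chebyshev_T (Suc (Suc k) + j) =
      ?X * (chebyshev_T (Suc k) * chebyshev_T (Suc k + Suc j)) - chebyshev_T k * chebyshev_T (k + Suc (Suc j))"
    by (simp only: chebyshev_T.simps(3)) (simp add: algebra_simps)
  also have "\<dots> = (?X * chebyshev_T (Suc (2 * k + j + 2)) - chebyshev_T (2 * k + j + 2)) +
      (?X * chebyshev_T (Suc j) - chebyshev_T (Suc (Suc j)))"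
    using "3.IH"(1)[of "Suc j"] "3.IH"(2)[of "Suc (Suc j)"]
    by (simp add: algebra_simps del: chebyshev_T.simps)
  also have "?X * chebyshev_T (Suc (2 * k + j + 2)) - chebyshev_T (2 * k + j + 2) = chebyshev_T (2 * Suc (Suc k) + j)"
    by (simp add: eval_nat_numeral del: mult_pCons_left mult_pCons_right)
  finally show ?case by simp
qed

lemma poly_op_zero_arg [simp]: "poly_op i \<mu> p (\<lambda>n. 0) = (\<lambda>n. 0)"
  using poly_op_cmult_arg[of i \<mu> p 0 "\<lambda>n. 0"] by simp

lemma finite_support_shift:
  assumes "finite {n. u n \<noteq> 0}"
  shows "finite {n. shift a u n \<noteq> 0}"
proof -
  have "{n. shift a u n \<noteq> 0} \<subseteq> (\<lambda>n. n - a) ` {n. u n \<noteq> 0}"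
    by (force simp: shift_def image_iff)
  then show ?thesis using assms finite_surj by blast
qed

lemma finite_support_transversal_op:
  assumes "finite {n. u n \<noteq> 0}"
  shows "finite {n. transversal_op i \<mu> u n \<noteq> 0}"
proof -
  have "{n. transversal_op i \<mu> u n \<noteq> 0} \<subseteq> {n. u n \<noteq> 0} \<union>
      (\<Union>j. {n. shift (axis j 1) u n \<noteq> 0} \<union> {n. shift (- axis j 1) u n \<noteq> 0})"
    by (auto simp: transversal_op_def intro!: sum.neutral)
  then show ?thesis
    by (rule finite_subset) (intro finite_UnI finite_UN_I finite_support_shift assms finite)
qed

lemma finite_support_poly_op:
  assumes "finite {n. u n \<noteq> 0}"
  shows "finite {n. poly_op i \<mu> p u n \<noteq> 0}"
proof (induction p)
  case (pCons a p)
  have "{n. poly_op i \<mu> (pCons a p) u n \<noteq> 0} \<subseteq>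
      {n. u n \<noteq> 0} \<union> {n. transversal_op i \<mu> (poly_op i \<mu> p u) n \<noteq> 0}"
    by (auto simp: poly_op_pCons)
  then show ?case
    using assms finite_support_transversal_op[OF pCons.IH] finite_subset by blast
qed simp

text \<open>By symmetry the polynomials move onto \<phi>, where they are bounded uniformly in
  \<open>k\<close>, while \<open>v k\<close> tends to 0. The left side does not depend on
  \<open>k\<close>, so it vanishes.\<close>

lemma pairing_eq_0_if_wronskian:
  assumes v: "\<And>k. square_summable_on (v k) (slice i 0)" "(\<lambda>k. square_norm_on (v k) (slice i 0)) \<longlonglongrightarrow> 0"
    and \<phi>: "square_summable_on \<phi> (slice i 0)"
      "\<And>k. square_summable_on (poly_op i \<mu> (P k) \<phi>) (slice i 0)"
      "\<And>k. square_norm_on (poly_op i \<mu> (P k) \<phi>) (slice i 0) \<le> B"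
    and b: "\<And>k n. k \<ge> R \<Longrightarrow> n \<in> slice i 0 \<Longrightarrow>
      b n = poly_op i \<mu> (P k) (v (Suc k)) n - poly_op i \<mu> (P (Suc k)) (v k) n"
  shows "pairing (slice i 0) b \<phi> = 0"
proof -
  let ?S = "slice i 0" and ?N = "\<lambda>k. square_norm_on (v k) (slice i 0)"
  have "cmod (pairing ?S b \<phi>) \<le> sqrt (?N (Suc k) * B) + sqrt (?N k * B)" if "k \<ge> R" for k
  proof -
    have bound: "cmod (pairing ?S (poly_op i \<mu> (P k) (v l)) \<phi>) \<le> sqrt (?N l * B)" for k l
    proof -
      have "cmod (pairing ?S (poly_op i \<mu> (P k) (v l)) \<phi>) = cmod (pairing ?S (v l) (poly_op i \<mu> (P k) \<phi>))"
        by (simp add: pairing_poly_op v \<phi>)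
      also have "\<dots> \<le> sqrt (?N l * square_norm_on (poly_op i \<mu> (P k) \<phi>) ?S)"
        by (rule cauchy_schwarz_infsum(2)[OF v(1) \<phi>(2)])
      also have "\<dots> \<le> sqrt (?N l * B)"
        by (intro real_sqrt_le_mono mult_left_mono \<phi> square_norm_on_nonneg)
      finally show ?thesis .
    qed
    have "pairing ?S b \<phi> = pairing ?S (\<lambda>n. poly_op i \<mu> (P k) (v (Suc k)) n - poly_op i \<mu> (P (Suc k)) (v k) n) \<phi>"
      by (rule pairing_cong) (use b that in auto)
    also have "\<dots> = pairing ?S (poly_op i \<mu> (P k) (v (Suc k))) \<phi> - pairing ?S (poly_op i \<mu> (P (Suc k)) (v k)) \<phi>"
      by (intro pairing_diff_left square_summable_poly_op v \<phi>)
    finally show ?thesis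
      using norm_triangle_ineq4 bound by (smt (verit, best))
  qed
  moreover have "(\<lambda>k. sqrt (?N (Suc k) * B) + sqrt (?N k * B)) \<longlonglongrightarrow> sqrt (0 * B) + sqrt (0 * B)"
    using LIMSEQ_Suc[OF v(2)] by (intro tendsto_intros v(2))
  ultimately have "cmod (pairing ?S b \<phi>) \<le> sqrt (0 * B) + sqrt (0 * B)"
    by (intro LIMSEQ_le_const) auto
  then show ?thesis by simp
qed

text \<open>The sign \<sigma> points to the side of slice 0 that contains the whole source
  \<open>f\<close>; the other side and the slice itself are free of it. Other slices are reached by
  translation.\<close>

lemma rellich_half_space:
  fixes u :: "int ^ 'd \<Rightarrow> complex" and i :: 'd and \<sigma> :: int
  assumes E: "0 < E" "E < real CARD('d)" "\<mu> = 2 * real CARD('d) - 4 * E"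
    and u: "square_summable_on u UNIV"
    and f: "f = (\<lambda>n. u (n + axis i 1) + u (n - axis i 1) - transversal_op i \<mu> u n)"
    and fin: "finite {n. f n \<noteq> 0}"
    and \<sigma>: "\<bar>\<sigma>\<bar> = 1" and half: "\<And>n. \<sigma> * (n $ i) \<le> 0 \<Longrightarrow> f n = 0"
    and n: "n \<in> slice i 0"
  shows "u n = 0"
proof -
  define S where "S = slice i (0 :: int)"
  \<comment> \<open>\<open>v\<close> runs through the slices towards the source, \<open>v'\<close>
    through those away from it; \<open>F\<close> and \<open>F'\<close> are the sources along the two
    directions.\<close>
  define v where "v k = shift (axis i (\<sigma> * int k)) u" for k
  define v' where "v' k = shift (axis i (- \<sigma> * int k)) u" for k
  define F where "F k = shift (axis i (\<sigma> * int (Suc k))) f" for k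
  define F' where "F' k = shift (axis i (- \<sigma> * int (Suc k))) f" for k
  \<comment> \<open>Even and odd combinations: \<open>w 0\<close> is \<open>2 u\<close> and
    \<open>z 0\<close> is 0, which makes the boundary terms at 0 explicit.\<close>
  define w where "w k n = v k n + v' k n" for k n
  define z where "z k n = v k n - v' k n" for k n
  have \<sigma>_cases: "\<sigma> = 1 \<or> \<sigma> = -1" using \<sigma> by linarith

  have axis_Suc: "axis i (\<tau> * int (Suc k)) + axis i 1 = (if \<tau> = 1 then axis i (\<tau> * int (Suc (Suc k))) else axis i (\<tau> * int k))"
    "axis i (\<tau> * int (Suc k)) - axis i 1 = (if \<tau> = 1 then axis i (\<tau> * int k) else axis i (\<tau> * int (Suc (Suc k))))"
    if "\<tau> = 1 \<or> \<tau> = -1" for \<tau> k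
    using that by (auto simp: vec_eq_iff axis_def)
  \<comment> \<open>The equation is symmetric in \<open>axis i 1\<close> and
    \<open>- axis i 1\<close>, so the same recursion holds in both directions.\<close>
  have step: "shift (axis i (\<tau> * int (Suc k))) f n =
      shift (axis i (\<tau> * int (Suc (Suc k)))) u n + shift (axis i (\<tau> * int k)) u n -
      transversal_op i \<mu> (shift (axis i (\<tau> * int (Suc k))) u) n" if "\<tau> = 1 \<or> \<tau> = -1" for \<tau> k n
    using that by (auto simp: f transversal_op_shift shift_def add.assoc add_diff_eq[symmetric] axis_Suc
        simp del: of_nat_Suc)
  have F: "F k n = v (Suc (Suc k)) n + v k n - transversal_op i \<mu> (v (Suc k)) n" for k n
    unfolding F_def v_def by (rule step[OF \<sigma>_cases])
  have F': "F' k n = v' (Suc (Suc k)) n + v' k n - transversal_op i \<mu> (v' (Suc k)) n" for k n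
    unfolding F'_def v'_def by (rule step) (use \<sigma>_cases in auto)
  have F'0: "F' k n = 0" if "n \<in> S" for k n
    unfolding F'_def shift_def using that \<sigma>_cases by (intro half) (auto simp: S_def slice_def)
  obtain R where FR: "\<And>k n. k \<ge> R \<Longrightarrow> n \<in> S \<Longrightarrow> F k n = 0"
  proof -
    define R where "R = nat (\<Sum>n | f n \<noteq> 0. \<bar>n $ i\<bar>)"
    have "F k n = 0" if k: "k \<ge> R" and n: "n \<in> S" for k n
    proof (rule ccontr)
      assume "F k n \<noteq> 0"
      then have "\<bar>(n + axis i (\<sigma> * int (Suc k))) $ i\<bar> \<le> (\<Sum>n | f n \<noteq> 0. \<bar>n $ i\<bar>)"
        using fin by (intro member_le_sum[where f = "\<lambda>n. \<bar>n $ i\<bar>"]) (auto simp: F_def shift_def)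
      then have "int (Suc k) \<le> (\<Sum>n | f n \<noteq> 0. \<bar>n $ i\<bar>)"
        using n \<sigma> by (simp add: S_def slice_def abs_mult)
      then show False using k by (simp add: R_def)
    qed
    then show thesis by (rule that)
  qed
  have v_summable: "square_summable_on (v k) S" and v'_summable: "square_summable_on (v' k) S" for k
    using square_summable_on_shift(1)[of "axis i (\<sigma> * int k)" i "\<sigma> * int k" 0 u]
      square_summable_on_shift(1)[of "axis i (- \<sigma> * int k)" i "- \<sigma> * int k" 0 u]
      square_summable_on_subset[OF u]
    by (simp_all add: v_def v'_def S_def)
  have v_norm: "square_norm_on (v k) S = square_norm_on u (slice i (\<sigma> * int k))"
    and v'_norm: "square_norm_on (v' k) S = square_norm_on u (slice i (- \<sigma> * int k))" for k
    using square_summable_on_shift(2)[of "axis i (\<sigma> * int k)" i "\<sigma> * int k" 0 u]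
      square_summable_on_shift(2)[of "axis i (- \<sigma> * int k)" i "- \<sigma> * int k" 0 u]
    by (simp_all add: v_def v'_def S_def)
  have v_lim: "(\<lambda>k. square_norm_on (v k) S) \<longlonglongrightarrow> 0" and v'_lim: "(\<lambda>k. square_norm_on (v' k) S) \<longlonglongrightarrow> 0"
  proof -
    have "(\<lambda>k. square_norm_on u (slice i (\<tau> * int k))) \<longlonglongrightarrow> 0" if "\<bar>\<tau>\<bar> = 1" for \<tau>
    proof (rule LIMSEQ_I)
      fix \<epsilon> :: real assume "0 < \<epsilon>"
      then obtain R where R: "\<And>k. \<bar>k\<bar> \<ge> R \<Longrightarrow> square_norm_on u (slice i k) < \<epsilon>"
        using square_norm_slice_small[OF u] by blast
      then have "\<forall>k\<ge>nat R. norm (square_norm_on u (slice i (\<tau> * int k)) - 0) < \<epsilon>"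
        using that by (auto simp: abs_mult square_norm_on_nonneg)
      then show "\<exists>N. \<forall>k\<ge>N. norm (square_norm_on u (slice i (\<tau> * int k)) - 0) < \<epsilon>" by blast
    qed
    from this[of \<sigma>] this[of "- \<sigma>"] \<sigma> show "(\<lambda>k. square_norm_on (v k) S) \<longlonglongrightarrow> 0" "(\<lambda>k. square_norm_on (v' k) S) \<longlonglongrightarrow> 0"
      by (simp_all add: v_norm v'_norm)
  qed
  have w_summable: "square_summable_on (w k) S" and z_summable: "square_summable_on (z k) S" for k
    unfolding w_def[abs_def] z_def[abs_def]
    by (intro square_summable_on_add square_summable_on_diff v_summable v'_summable)+
  have wz_le: "square_norm_on (w k) S \<le> 2 * square_norm_on (v k) S + 2 * square_norm_on (v' k) S"
    "square_norm_on (z k) S \<le> 2 * square_norm_on (v k) S + 2 * square_norm_on (v' k) S" for k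
    using square_summable_on_add(2)[OF v_summable[of k] v'_summable[of k]]
      square_summable_on_add(2)[OF v_summable[of k] square_summable_on_cmult[OF v'_summable[of k], of "-1"]]
    by (simp_all add: w_def[abs_def] z_def[abs_def] square_norm_on_def[of "\<lambda>n. - v' k n"] square_norm_on_def[of "v' k"])
  have lim0: "(\<lambda>k. 2 * square_norm_on (v k) S + 2 * square_norm_on (v' k) S) \<longlonglongrightarrow> 0"
    using tendsto_add[OF tendsto_mult_left[OF v_lim, of 2] tendsto_mult_left[OF v'_lim, of 2]] by simp
  have w_lim: "(\<lambda>k. square_norm_on (w k) S) \<longlonglongrightarrow> 0" and z_lim: "(\<lambda>k. square_norm_on (z k) S) \<longlonglongrightarrow> 0"
    using wz_le
    by (auto intro!: tendsto_sandwich[OF _ _ tendsto_const lim0] always_eventually simp: square_norm_on_nonneg)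

  \<comment> \<open>From index \<open>R\<close> on the source vanishes on \<open>S\<close>, so the
    cutoff may be raised freely. As \<open>F'\<close> vanishes on \<open>S\<close>, it may also be
    added to or subtracted from \<open>F\<close>.\<close>
  define a where "a P n = (\<Sum>k<R. poly_op i \<mu> (P (Suc k)) (F k) n)" for P :: "nat \<Rightarrow> real poly" and n
  have a_eq: "a P n = (\<Sum>k<K. poly_op i \<mu> (P (Suc k)) (G k) n)"
    if "K \<ge> R" "n \<in> S" "\<And>k n. n \<in> S \<Longrightarrow> G k n = F k n" for P K G n
  proof -
    have "(\<Sum>k<K. poly_op i \<mu> (P (Suc k)) (G k) n) = (\<Sum>k<K. poly_op i \<mu> (P (Suc k)) (F k) n)"
      using that by (intro sum.cong refl poly_op_cong[of i 0]) (auto simp: S_def)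
    also have "\<dots> = a P n"
      unfolding a_def
    proof (rule sum.mono_neutral_right)
      show "\<forall>k\<in>{..<K} - {..<R}. poly_op i \<mu> (P (Suc k)) (F k) n = 0"
      proof
        fix k assume "k \<in> {..<K} - {..<R}"
        then have "poly_op i \<mu> (P (Suc k)) (F k) n = poly_op i \<mu> (P (Suc k)) (\<lambda>n. 0) n"
          using FR that(2) by (intro poly_op_cong[of i 0]) (auto simp: S_def)
        then show "poly_op i \<mu> (P (Suc k)) (F k) n = 0" by simp
      qed
    qed (use that in auto)
    finally show ?thesis by simp
  qed
  have u0: "v 0 = u" "v' 0 = u"
    by (simp_all add: v_def v'_def shift_def fun_eq_iff axis_def zero_vec_def[symmetric])
  \<comment> \<open>This is the equation on slice 0 itself, which is free of the source.\<close>
  have w1: "w (Suc 0) n = transversal_op i \<mu> u n" if "n \<in> S" for n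
  proof -
    have "f n = 0" using that by (intro half) (simp add: S_def slice_def)
    moreover have "axis i (-1) = - (axis i 1 :: int ^ 'd)" by (simp add: vec_eq_iff axis_def)
    ultimately show ?thesis using \<sigma>_cases by (auto simp: w_def v_def v'_def shift_def f add.commute)
  qed
  have aT: "a chebyshev_T n = poly_op i \<mu> (chebyshev_T K) (w (Suc K)) n - poly_op i \<mu> (chebyshev_T (Suc K)) (w K) n"
    if "K \<ge> R" "n \<in> S" for K n
  proof -
    have "a chebyshev_T n = (\<Sum>k<K. poly_op i \<mu> (chebyshev_T (Suc k)) (\<lambda>n. F k n + F' k n) n)"
      using that by (intro a_eq) (auto simp: F'0)
    also have "\<dots> = (poly_op i \<mu> (chebyshev_T K) (w (Suc K)) n - poly_op i \<mu> (chebyshev_T (Suc K)) (w K) n) -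
        (poly_op i \<mu> (chebyshev_T 0) (w (Suc 0)) n - poly_op i \<mu> (chebyshev_T (Suc 0)) (w 0) n)"
      by (rule green_formula) (simp_all add: F F' w_def[abs_def] transversal_op_add fun_eq_iff)
    \<comment> \<open>Both terms equal twice the transversal operator applied to \<open>u\<close>,
      since \<open>chebyshev_T\<close> starts with 2 and the variable.\<close>
    also have "poly_op i \<mu> (chebyshev_T 0) (w (Suc 0)) n - poly_op i \<mu> (chebyshev_T (Suc 0)) (w 0) n = 0"
      using w1[OF that(2)] by (simp add: poly_op_const poly_op_X w_def[of 0, abs_def] u0 transversal_op_cmult)
    finally show ?thesis by simp
  qed
  \<comment> \<open>The odd combination leaves no boundary term and is used to show that the sum
    vanishes. The even one leaves \<open>2 * u n\<close>, the relation that brings \<open>u\<close>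
    in.\<close>
  have aU: "a chebyshev_U n = poly_op i \<mu> (chebyshev_U K) (z (Suc K)) n - poly_op i \<mu> (chebyshev_U (Suc K)) (z K) n"
    "a chebyshev_U n = poly_op i \<mu> (chebyshev_U K) (w (Suc K)) n - poly_op i \<mu> (chebyshev_U (Suc K)) (w K) n + 2 * u n"
    if "K \<ge> R" "n \<in> S" for K n
  proof -
    have "a chebyshev_U n = (\<Sum>k<K. poly_op i \<mu> (chebyshev_U (Suc k)) (\<lambda>n. F k n - F' k n) n)"
      using that by (intro a_eq) (auto simp: F'0)
    also have "\<dots> = (poly_op i \<mu> (chebyshev_U K) (z (Suc K)) n - poly_op i \<mu> (chebyshev_U (Suc K)) (z K) n) -
        (poly_op i \<mu> (chebyshev_U 0) (z (Suc 0)) n - poly_op i \<mu> (chebyshev_U (Suc 0)) (z 0) n)"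
      by (rule green_formula) (simp_all add: F F' z_def[abs_def] transversal_op_diff fun_eq_iff)
    finally show "a chebyshev_U n = poly_op i \<mu> (chebyshev_U K) (z (Suc K)) n - poly_op i \<mu> (chebyshev_U (Suc K)) (z K) n"
      by (simp add: z_def[of 0, abs_def] u0)
    have "a chebyshev_U n = (\<Sum>k<K. poly_op i \<mu> (chebyshev_U (Suc k)) (\<lambda>n. F k n + F' k n) n)"
      using that by (intro a_eq) (auto simp: F'0)
    also have "\<dots> = (poly_op i \<mu> (chebyshev_U K) (w (Suc K)) n - poly_op i \<mu> (chebyshev_U (Suc K)) (w K) n) -
        (poly_op i \<mu> (chebyshev_U 0) (w (Suc 0)) n - poly_op i \<mu> (chebyshev_U (Suc 0)) (w 0) n)"
      by (rule green_formula) (simp_all add: F F' w_def[abs_def] transversal_op_add fun_eq_iff)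
    finally show "a chebyshev_U n = poly_op i \<mu> (chebyshev_U K) (w (Suc K)) n - poly_op i \<mu> (chebyshev_U (Suc K)) (w K) n + 2 * u n"
      by (simp add: w_def[of 0, abs_def] u0 one_pCons poly_op_const)
  qed
  have fin_a: "finite {n \<in> slice i 0. a P n \<noteq> 0}" for P
  proof -
    have "{n \<in> slice i 0. a P n \<noteq> 0} \<subseteq> (\<Union>k<R. {n. poly_op i \<mu> (P (Suc k)) (F k) n \<noteq> 0})"
      by (auto simp: a_def intro: ccontr sum.neutral)
    then show ?thesis
      by (rule finite_subset) (auto simp: F_def intro!: finite_support_poly_op finite_support_shift fin)
  qed
  have aT_0: "a chebyshev_T n = 0" if "n \<in> S" for n
  proof (rule eq_0_if_annihilates_chebyshev_bounded[OF E fin_a, of chebyshev_T n])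
    fix \<phi> B
    assume *: "\<And>k. square_summable_on (poly_op i \<mu> (chebyshev_T k) \<phi>) (slice i 0) \<and>
           square_norm_on (poly_op i \<mu> (chebyshev_T k) \<phi>) (slice i 0) \<le> B \<and>
           square_summable_on (poly_op i \<mu> (chebyshev_U k) \<phi>) (slice i 0) \<and>
           square_norm_on (poly_op i \<mu> (chebyshev_U k) \<phi>) (slice i 0) \<le> B"
    have "square_summable_on \<phi> (slice i 0)"
      using *[of "Suc 0"] by (simp add: one_pCons poly_op_const)
    then show "pairing (slice i 0) (a chebyshev_T) \<phi> = 0"
      using * w_summable w_lim aT
      by (intro pairing_eq_0_if_wronskian[where v = w and P = chebyshev_T and B = B and R = R]) (auto simp: S_def)
  qed (use that in \<open>simp add: S_def\<close>)
  have aU_0: "a chebyshev_U n = 0" if "n \<in> S" for n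
  proof (rule eq_0_if_annihilates_chebyshev_bounded[OF E fin_a, of chebyshev_U n])
    fix \<phi> B
    assume *: "\<And>k. square_summable_on (poly_op i \<mu> (chebyshev_T k) \<phi>) (slice i 0) \<and>
           square_norm_on (poly_op i \<mu> (chebyshev_T k) \<phi>) (slice i 0) \<le> B \<and>
           square_summable_on (poly_op i \<mu> (chebyshev_U k) \<phi>) (slice i 0) \<and>
           square_norm_on (poly_op i \<mu> (chebyshev_U k) \<phi>) (slice i 0) \<le> B"
    have "square_summable_on \<phi> (slice i 0)"
      using *[of "Suc 0"] by (simp add: one_pCons poly_op_const)
    then show "pairing (slice i 0) (a chebyshev_U) \<phi> = 0"
      using * z_summable z_lim aU(1)
      by (intro pairing_eq_0_if_wronskian[where v = z and P = chebyshev_U and B = B and R = R]) (auto simp: S_def)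
  qed (use that in \<open>simp add: S_def\<close>)

  have T_u: "poly_op i \<mu> (chebyshev_T K) u n = w K n" if K: "K \<ge> R" and n: "n \<in> S" for K n
  proof -
    let ?T = "chebyshev_T" and ?U = "chebyshev_U"
    have 1: "poly_op i \<mu> (?T K) (w (Suc K)) n = poly_op i \<mu> (?T (Suc K)) (w K) n" if "n \<in> S" for n
      using aT[OF K that] aT_0[OF that] by simp
    have 2: "poly_op i \<mu> (?U (Suc K)) (w K) n = poly_op i \<mu> (?U K) (w (Suc K)) n + 2 * u n" if "n \<in> S" for n
      using aU(2)[OF K that] aU_0[OF that] by (simp add: algebra_simps)
    \<comment> \<open>Cramer's rule: \<open>w (Suc K)\<close> is eliminated from the relations 1 and
      2, whose determinant is the constant Wronskian.\<close>
    have "2 * w K n = poly_op i \<mu> (?T K * ?U (Suc K) - ?U K * ?T (Suc K)) (w K) n"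
      by (simp only: chebyshev_wronskian poly_op_const) simp
    also have "\<dots> = poly_op i \<mu> (?T K) (poly_op i \<mu> (?U (Suc K)) (w K)) n -
        poly_op i \<mu> (?U K) (poly_op i \<mu> (?T (Suc K)) (w K)) n"
      by (simp only: poly_op_diff poly_op_mult)
    also have "poly_op i \<mu> (?T K) (poly_op i \<mu> (?U (Suc K)) (w K)) n =
        poly_op i \<mu> (?T K) (\<lambda>n. poly_op i \<mu> (?U K) (w (Suc K)) n + 2 * u n) n"
      using n 2 unfolding S_def by (intro poly_op_cong[of i 0])
    also have "\<dots> = poly_op i \<mu> (?T K) (poly_op i \<mu> (?U K) (w (Suc K))) n + 2 * poly_op i \<mu> (?T K) u n"
      by (simp only: poly_op_add_arg poly_op_cmult_arg)
    also have "poly_op i \<mu> (?U K) (poly_op i \<mu> (?T (Suc K)) (w K)) n =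
        poly_op i \<mu> (?U K) (poly_op i \<mu> (?T K) (w (Suc K))) n"
      using n 1[symmetric] unfolding S_def by (intro poly_op_cong[of i 0])
    also have "\<dots> = poly_op i \<mu> (?T K) (poly_op i \<mu> (?U K) (w (Suc K))) n"
      by (simp only: poly_op_mult[symmetric] mult.commute)
    finally show ?thesis by simp
  qed
  define N where "N = square_norm_on u S"
  have u_summable: "square_summable_on u S"
    using v_summable[of 0] by (simp add: u0)
  have cnj_summable: "square_summable_on (\<lambda>n. cnj (u n)) S"
    using u_summable by (simp add: square_summable_on_def)
  have bound: "2 * N \<le> square_norm_on (w K) S + sqrt (square_norm_on (w (2 * K)) S * N)" if "K \<ge> R" for K
  proof -
    have "complex_of_real (square_norm_on (w K) S) = pairing S (w K) (\<lambda>n. cnj (w K n))"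
      using pairing_cnj[OF w_summable] by simp
    also have "\<dots> = pairing S (poly_op i \<mu> (chebyshev_T K) u) (poly_op i \<mu> (chebyshev_T K) (\<lambda>n. cnj (u n)))"
      using T_u[OF that] by (intro pairing_cong) (auto simp: poly_op_cnj)
    also have "\<dots> = pairing S (poly_op i \<mu> (chebyshev_T K) (poly_op i \<mu> (chebyshev_T K) u)) (\<lambda>n. cnj (u n))"
      unfolding S_def
      by (rule pairing_poly_op[symmetric]) (use u_summable cnj_summable in \<open>auto simp: S_def intro!: square_summable_poly_op\<close>)
    \<comment> \<open>Squaring doubles the degree, so the result can again be read off from
      \<open>T_u\<close>, now at \<open>2 * K\<close>.\<close>
    also have "poly_op i \<mu> (chebyshev_T K) (poly_op i \<mu> (chebyshev_T K) u) =
        (\<lambda>n. poly_op i \<mu> (chebyshev_T (2 * K)) u n + 2 * u n)"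
      unfolding poly_op_mult[symmetric] using chebyshev_T_mult[of K 0] by (simp add: poly_op_add poly_op_const)
    also have "pairing S \<dots> (\<lambda>n. cnj (u n)) = pairing S (\<lambda>n. w (2 * K) n + 2 * u n) (\<lambda>n. cnj (u n))"
      using T_u[of "2 * K"] that by (intro pairing_cong) auto
    also have "\<dots> = pairing S (w (2 * K)) (\<lambda>n. cnj (u n)) + 2 * of_real N"
      by (subst pairing_add_left[OF w_summable square_summable_on_cmult[OF u_summable] cnj_summable])
         (simp add: pairing_cmult_left pairing_cnj[OF u_summable] N_def)
    finally have "complex_of_real (2 * N - square_norm_on (w K) S) = - pairing S (w (2 * K)) (\<lambda>n. cnj (u n))"
      by (simp add: algebra_simps)
    then have "\<bar>2 * N - square_norm_on (w K) S\<bar> = cmod (pairing S (w (2 * K)) (\<lambda>n. cnj (u n)))"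
      by (metis norm_minus_cancel norm_of_real)
    also have "\<dots> \<le> sqrt (square_norm_on (w (2 * K)) S * square_norm_on (\<lambda>n. cnj (u n)) S)"
      by (rule cauchy_schwarz_infsum(2)[OF w_summable cnj_summable])
    also have "square_norm_on (\<lambda>n. cnj (u n)) S = N"
      by (simp add: square_norm_on_def N_def)
    finally show ?thesis by linarith
  qed
  have "(\<lambda>K. square_norm_on (w (2 * K)) S) \<longlonglongrightarrow> 0"
    using LIMSEQ_subseq_LIMSEQ[OF w_lim, of "\<lambda>K. 2 * K"] by (simp add: strict_mono_def comp_def)
  then have "(\<lambda>K. square_norm_on (w K) S + sqrt (square_norm_on (w (2 * K)) S * N)) \<longlonglongrightarrow> 0 + sqrt (0 * N)"
    by (intro tendsto_intros w_lim)
  \<comment> \<open>In the limit the whole right side disappears, which forces the norm of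
    \<open>u\<close> on the slice to be 0.\<close>
  then have "2 * N \<le> 0 + sqrt (0 * N)"
    using bound by (intro LIMSEQ_le_const) auto
  then have "N \<le> 0" by simp
  moreover have "(\<Sum>m\<in>{n}. (cmod (u m))\<^sup>2) \<le> N"
    unfolding N_def using n by (intro sum_le_square_norm_on u_summable) (auto simp: S_def)
  ultimately have "(\<Sum>m\<in>{n}. (cmod (u m))\<^sup>2) \<le> 0" by linarith
  then show ?thesis by simp
qed

section \<open>From half spaces to finite support\<close>

lemma transversal_op_eq_laplacian:
  fixes u :: "int ^ 'd \<Rightarrow> complex"
  assumes "\<mu> = 2 * real CARD('d) - 4 * E"
  shows "u (n + axis i 1) + u (n - axis i 1) - transversal_op i \<mu> u n = 4 * (laplacian u n + of_real E * u n)"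
proof -
  have "(\<Sum>j\<in>UNIV. u (n + axis j 1) + u (n - axis j 1)) =
      u (n + axis i 1) + u (n - axis i 1) + (\<Sum>j\<in>UNIV - {i}. u (n + axis j 1) + u (n - axis j 1))"
    by (rule sum.remove) auto
  then show ?thesis
    by (simp add: assms laplacian_def transversal_op_def shift_def algebra_simps)
qed

lemma finite_lattice_box: "finite {n :: int ^ 'd. \<forall>i. \<bar>n $ i\<bar> \<le> M}"
proof -
  have "finite {f :: 'd \<Rightarrow> int. \<forall>i. f i \<in> {- M..M}}"
    using finite_PiE[of "UNIV :: 'd set" "\<lambda>i. {- M..M}"] by (simp add: PiE_UNIV_domain Pi_def)
  moreover have "{n :: int ^ 'd. \<forall>i. \<bar>n $ i\<bar> \<le> M} \<subseteq> vec_lambda ` {f. \<forall>i. f i \<in> {- M..M}}"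
  proof
    fix n :: "int ^ 'd" assume n: "n \<in> {n. \<forall>i. \<bar>n $ i\<bar> \<le> M}"
    have "- M \<le> n $ i \<and> n $ i \<le> M" for i
      using n abs_le_D1[of "n $ i" M] abs_le_D2[of "n $ i" M] by auto
    then show "n \<in> vec_lambda ` {f. \<forall>i. f i \<in> {- M..M}}"
      by (intro image_eqI[of _ _ "vec_nth n"]) (simp_all add: vec_lambda_eta)
  qed
  ultimately show ?thesis using finite_surj by blast
qed

lemma finite_lattice_set_bounded:
  assumes "finite (G :: (int ^ 'd) set)"
  shows "\<exists>M. \<forall>n\<in>G. \<forall>i. \<bar>n $ i\<bar> < M"
proof (intro exI ballI allI)
  fix n i assume "n \<in> G"
  have "\<bar>n $ i\<bar> \<le> (\<Sum>i\<in>UNIV. \<bar>n $ i\<bar>)" by (rule member_le_sum[where f = "\<lambda>i. \<bar>n $ i\<bar>"]) auto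
  also have "\<dots> \<le> (\<Sum>n\<in>G. \<Sum>i\<in>UNIV. \<bar>n $ i\<bar>)"
    by (rule member_le_sum[where f = "\<lambda>n. \<Sum>i\<in>UNIV. \<bar>n $ i\<bar>", OF \<open>n \<in> G\<close>]) (simp_all add: sum_nonneg assms)
  finally show "\<bar>n $ i\<bar> < (\<Sum>n\<in>G. \<Sum>i\<in>UNIV. \<bar>n $ i\<bar>) + 1" by simp
qed

text \<open>Every slice outside a box around the source has the source strictly on one side. The
  half space lemma, applied in each coordinate direction, confines the support of \<open>u\<close>
  to that box.\<close>

lemma rellich_finite_support:
  fixes u :: "int ^ 'd \<Rightarrow> complex"
  assumes E: "0 < E" "E < real CARD('d)"
    and u: "square_summable_on u UNIV"
    and fin: "finite {n. laplacian u n + of_real E * u n \<noteq> 0}"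
  shows "finite {n. u n \<noteq> 0}"
proof -
  define \<mu> where "\<mu> = 2 * real CARD('d) - 4 * E"
  obtain M where M: "\<forall>n\<in>{n. laplacian u n + of_real E * u n \<noteq> 0}. \<forall>i. \<bar>n $ i\<bar> < M"
    using finite_lattice_set_bounded[OF fin] by blast
  have "u n = 0" if "\<bar>n $ i\<bar> > \<bar>M\<bar>" for n i
  proof -
    define c where "c = n $ i"
    \<comment> \<open>After translating the slice to position 0, the source lies back in the
      direction of the old origin, hence the minus sign.\<close>
    define \<sigma> where "\<sigma> = - sgn c"
    define w where "w = shift (axis i c) u"
    have c: "\<bar>c\<bar> > \<bar>M\<bar>" using that by (simp add: c_def)
    have f: "w (m + axis i 1) + w (m - axis i 1) - transversal_op i \<mu> w m =
        4 * (laplacian u (m + axis i c) + of_real E * u (m + axis i c))" for m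
      using transversal_op_eq_laplacian[OF \<mu>_def, of u "m + axis i c" i]
      by (simp add: w_def transversal_op_shift shift_def algebra_simps)
    have "w (n - axis i c) = 0"
    proof (rule rellich_half_space[OF E \<mu>_def _ refl])
      show "square_summable_on w UNIV"
        using summable_on_reindex_bij_betw[OF bij_plus_right[of "axis i c"], of "\<lambda>n. (cmod (u n))\<^sup>2"] u
        by (simp add: w_def square_summable_on_def shift_def)
      have "finite {m. shift (axis i c) (\<lambda>n. laplacian u n + of_real E * u n) m \<noteq> 0}"
        by (rule finite_support_shift[OF fin])
      then show "finite {m. w (m + axis i 1) + w (m - axis i 1) - transversal_op i \<mu> w m \<noteq> 0}"
        unfolding f by (simp add: shift_def del: distrib_left_numeral)
      show "\<bar>\<sigma>\<bar> = 1" using c by (auto simp: \<sigma>_def sgn_if)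
      show "w (m + axis i 1) + w (m - axis i 1) - transversal_op i \<mu> w m = 0" if "\<sigma> * (m $ i) \<le> 0" for m
      proof -
        have "\<not> \<bar>(m + axis i c) $ i\<bar> < M"
          using that c by (auto simp: \<sigma>_def sgn_if split: if_splits)
        then have "laplacian u (m + axis i c) + of_real E * u (m + axis i c) = 0"
          using M by blast
        then show ?thesis unfolding f by simp
      qed
      show "n - axis i c \<in> slice i 0" by (simp add: slice_def c_def)
    qed
    then show ?thesis by (simp add: w_def shift_def)
  qed
  then have "{n. u n \<noteq> 0} \<subseteq> {n. \<forall>i. \<bar>n $ i\<bar> \<le> \<bar>M\<bar>}"
    using linorder_not_less by blast
  then show ?thesis using finite_lattice_box finite_subset by blast
qed

section \<open>Unique continuation\<close>

text \<open>Squares of integers summing to 1 leave room for exactly one nonzero entry, which is 1 or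
  -1.\<close>

lemma lattice_sphere_eq:
  "{m :: int ^ 'd. lattice_norm (m - n) = 1} = (\<lambda>(j, s). n + axis j s) ` (UNIV \<times> {1, -1})"
proof (intro equalityI subsetI)
  fix m assume "m \<in> {m. lattice_norm (m - n) = 1}"
  then have "(\<Sum>i\<in>UNIV. (real_of_int ((m - n) $ i))\<^sup>2) = 1"
    by (simp add: lattice_norm_def)
  then have "real_of_int (\<Sum>i\<in>UNIV. ((m - n) $ i)\<^sup>2) = 1" by simp
  then have s: "(\<Sum>i\<in>UNIV. ((m - n) $ i)\<^sup>2) = 1" by linarith
  have "\<exists>j. (m - n) $ j \<noteq> 0"
  proof (rule ccontr)
    assume "\<nexists>j. (m - n) $ j \<noteq> 0"
    then have "(\<Sum>i\<in>UNIV. ((m - n) $ i)\<^sup>2) = 0" by (intro sum.neutral) auto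
    then show False using s by simp
  qed
  then obtain j where j: "(m - n) $ j \<noteq> 0" ..
  have "(\<Sum>i\<in>UNIV. ((m - n) $ i)\<^sup>2) = ((m - n) $ j)\<^sup>2 + (\<Sum>i\<in>UNIV - {j}. ((m - n) $ i)\<^sup>2)"
    by (rule sum.remove) auto
  moreover have "((m - n) $ j)\<^sup>2 \<ge> 1" using j by (simp add: int_one_le_iff_zero_less)
  moreover have nonneg: "(\<Sum>i\<in>UNIV - {j}. ((m - n) $ i)\<^sup>2) \<ge> 0" by (simp add: sum_nonneg)
  ultimately have "((m - n) $ j)\<^sup>2 = 1" and "(\<Sum>i\<in>UNIV - {j}. ((m - n) $ i)\<^sup>2) = 0"
    using s by linarith+
  then have j_cases: "(m - n) $ j \<in> {1, -1}" and "\<forall>i\<in>UNIV - {j}. (m - n) $ i = 0"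
    by (auto simp: power2_eq_1_iff sum_nonneg_eq_0_iff)
  then have "(m - n) $ i = axis j ((m - n) $ j) $ i" for i
    by (cases "i = j") (auto simp: axis_def)
  then have "m - n = axis j ((m - n) $ j)"
    unfolding vec_eq_iff by blast
  then have "m = (\<lambda>(j, s). n + axis j s) (j, (m - n) $ j)"
    unfolding prod.case by (metis add.commute diff_add_cancel)
  then show "m \<in> (\<lambda>(j, s). n + axis j s) ` (UNIV \<times> {1, -1})"
    by (rule image_eqI) (use j_cases in simp)
next
  fix m assume "m \<in> (\<lambda>(j, s). n + axis j s) ` (UNIV \<times> {1, -1})"
  then obtain j s where m: "m = n + axis j s" and s: "s \<in> {1, -1 :: int}" by auto
  have "(\<Sum>i\<in>UNIV. (real_of_int ((m - n) $ i))\<^sup>2) = (\<Sum>i\<in>UNIV. if i = j then 1 else 0)"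
    using s by (intro sum.cong) (auto simp: m axis_def)
  then show "m \<in> {m. lattice_norm (m - n) = 1}" by (simp add: lattice_norm_def)
qed

lemma lattice_interior_if_neighbours:
  fixes n :: "int ^ 'd"
  assumes "n \<in> \<Omega>" "\<And>j s. s \<in> {1, -1} \<Longrightarrow> n + axis j s \<in> \<Omega>"
  shows "n \<in> lattice_interior \<Omega>"
proof -
  have "inj_on (\<lambda>(j, s). n + axis j s) (UNIV \<times> {1, -1 :: int})"
    by (auto simp: inj_on_def axis_eq_axis)
  moreover have "{m \<in> \<Omega>. lattice_norm (m - n) = 1} = (\<lambda>(j, s). n + axis j s) ` (UNIV \<times> {1, -1})"
    unfolding lattice_sphere_eq[symmetric] using assms(2) lattice_sphere_eq[of n] by auto
  ultimately have "deg \<Omega> n = 2 * CARD('d)"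
    by (simp add: deg_def card_image card_cartesian_product)
  then show ?thesis using assms(1) by (simp add: lattice_interior_def)
qed

lemma finite_if_lattice_bounded:
  assumes "lattice_bounded (A :: (int ^ 'd) set)"
  shows "finite A"
proof -
  obtain R where R: "\<And>n. n \<in> A \<Longrightarrow> lattice_norm n \<le> R" using assms by (auto simp: lattice_bounded_def)
  have "\<bar>n $ i\<bar> \<le> \<lceil>R\<rceil>" if "n \<in> A" for n i
  proof -
    have "(real_of_int (n $ i))\<^sup>2 \<le> (\<Sum>i\<in>UNIV. (real_of_int (n $ i))\<^sup>2)"
      by (rule member_le_sum[where f = "\<lambda>i. (real_of_int (n $ i))\<^sup>2"]) auto
    then have "\<bar>real_of_int (n $ i)\<bar> \<le> lattice_norm n"
      unfolding lattice_norm_def by (metis real_sqrt_abs real_sqrt_le_mono)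
    then have "\<bar>real_of_int (n $ i)\<bar> \<le> R" using R[OF that] by linarith
    then show ?thesis by linarith
  qed
  then have "A \<subseteq> {n. \<forall>i. \<bar>n $ i\<bar> \<le> \<lceil>R\<rceil>}" by blast
  then show ?thesis using finite_lattice_box finite_subset by blast
qed

lemma transversal_distance_step:
  fixes m n :: "int ^ 'd"
  shows "(\<Sum>k\<in>UNIV - {i}. \<bar>(m + axis j s) $ k - n $ k\<bar>) \<le>
    (\<Sum>k\<in>UNIV - {i}. \<bar>m $ k - n $ k\<bar>) + (if j = i then 0 else \<bar>s\<bar>)"
proof -
  have "(\<Sum>k\<in>UNIV - {i}. \<bar>(m + axis j s) $ k - n $ k\<bar>) \<le>
      (\<Sum>k\<in>UNIV - {i}. \<bar>m $ k - n $ k\<bar> + (if k = j then \<bar>s\<bar> else 0))"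
    by (intro sum_mono) (auto simp: axis_def)
  also have "\<dots> = (\<Sum>k\<in>UNIV - {i}. \<bar>m $ k - n $ k\<bar>) + (if j = i then 0 else \<bar>s\<bar>)"
    by (simp add: sum.distrib)
  finally show ?thesis .
qed

text \<open>Inside a cone the equation at \<open>m + \<sigma> e\<^sub>i\<close> expresses \<open>u m\<close> through values of \<open>u\<close> at points of
  the cone that lie further along \<open>\<sigma> e\<^sub>i\<close>.\<close>

lemma unique_continuation_cone:
  fixes u :: "int ^ 'd \<Rightarrow> complex" and \<sigma> :: int
  assumes \<sigma>: "\<sigma> = 1 \<or> \<sigma> = -1"
    and cone: "{m. (\<Sum>k\<in>UNIV - {i}. \<bar>m $ k - n $ k\<bar>) \<le> \<sigma> * (m $ i - n $ i)} \<subseteq> \<Omega>"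
    and eq: "\<And>m. m \<in> lattice_interior \<Omega> \<Longrightarrow> laplacian u m + of_real E * u m = of_real (V m) * u m"
    and fin: "finite {n. u n \<noteq> 0}"
  shows "u n = 0"
proof -
  define C where "C = {m. (\<Sum>k\<in>UNIV - {i}. \<bar>m $ k - n $ k\<bar>) \<le> \<sigma> * (m $ i - n $ i)}"
  define level where "level m = \<sigma> * (m $ i - n $ i)" for m :: "int ^ 'd"
  obtain M where M: "\<forall>m\<in>{n. u n \<noteq> 0}. \<forall>i. \<bar>m $ i\<bar> < M"
    using finite_lattice_set_bounded[OF fin] by blast
  \<comment> \<open>From level \<open>L\<close> on, coordinate \<open>i\<close> alone has left the
    box containing the support of \<open>u\<close>.\<close>
  define L where "L = M + \<bar>n $ i\<bar>"
  have far: "u m = 0" if "level m \<ge> L" for m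
  proof (rule ccontr)
    assume "u m \<noteq> 0"
    then have "\<bar>m $ i\<bar> < M" using M by blast
    then show False using that \<sigma> by (auto simp: level_def L_def)
  qed
  \<comment> \<open>Induction on the distance to level \<open>L\<close>: it runs inwards, and points
    further along the axis of the cone are settled first.\<close>
  have "m \<in> C \<longrightarrow> u m = 0" for m
  proof (induction "nat (L - level m)" arbitrary: m rule: less_induct)
    case less
    show ?case
    proof
      assume m: "m \<in> C"
      show "u m = 0"
      proof (cases "level m \<ge> L")
        case False
        have IH: "u p = 0" if "p \<in> C" "level p > level m" for p
          using less[of p] that False by auto
        \<comment> \<open>One step along the axis gains slack 1 in the cone inequality. This is just
          enough for all neighbours of \<open>p\<close> to stay in the cone, so that
          \<open>p\<close> is an interior point; \<open>m\<close> is the only neighbour of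
          \<open>p\<close> on a level below that of \<open>p\<close>.\<close>
        define p where "p = m + axis i \<sigma>"
        have level_axis: "level (q + axis j s) = level q + (if j = i then \<sigma> * s else 0)" for q j s
          by (simp add: level_def axis_def algebra_simps)
        have C_step: "q + axis j s \<in> C" if "(\<Sum>k\<in>UNIV - {i}. \<bar>q $ k - n $ k\<bar>) + (if j = i then 0 else \<bar>s\<bar>) \<le> level (q + axis j s)" for q j s
          using transversal_distance_step[where i = i and m = q and j = j and s = s and n = n] that by (simp add: C_def level_def)
        have dist_p: "(\<Sum>k\<in>UNIV - {i}. \<bar>p $ k - n $ k\<bar>) \<le> level p - 1"
          using transversal_distance_step[where i = i and m = m and j = i and s = \<sigma> and n = n] m \<sigma> level_axis[of m i \<sigma>]
          by (auto simp: p_def C_def level_def)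
        have level_p: "level p = level m + 1" using \<sigma> by (auto simp: p_def level_axis)
        have p: "p \<in> C" using dist_p by (simp add: C_def level_def)
        have nbr: "p + axis j s \<in> C" if "s \<in> {1, -1}" for j s
          using dist_p that \<sigma> by (intro C_step) (auto simp: level_axis)
        have "p \<in> lattice_interior \<Omega>"
          using p nbr cone by (intro lattice_interior_if_neighbours) (auto simp: C_def)
        \<comment> \<open>The potential may be nonzero at \<open>p\<close>, but \<open>u p\<close>
          is already known to vanish.\<close>
        from eq[OF this] have "laplacian u p = 0"
          using IH[OF p] level_p by simp
        then have sum0: "(\<Sum>j\<in>UNIV. u (p + axis j 1) + u (p - axis j 1)) = 0"
          using IH[OF p] level_p by (simp add: laplacian_def)
        have minus: "p - axis j 1 = p + axis j (-1)" for j by (simp add: vec_eq_iff axis_def)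
        have "(\<Sum>j\<in>UNIV. u (p + axis j 1) + u (p - axis j 1)) =
            u (p + axis i 1) + u (p - axis i 1) + (\<Sum>j\<in>UNIV - {i}. u (p + axis j 1) + u (p - axis j 1))"
          by (rule sum.remove) auto
        also have "(\<Sum>j\<in>UNIV - {i}. u (p + axis j 1) + u (p - axis j 1)) = 0"
          using level_p by (intro sum.neutral ballI) (simp add: minus IH[OF nbr] level_axis)
        also have "u (p + axis i 1) + u (p - axis i 1) = u (p + axis i \<sigma>) + u (p + axis i (- \<sigma>))"
          using \<sigma> by (auto simp: minus)
        also have "u (p + axis i \<sigma>) = 0"
          using \<sigma> level_p by (intro IH nbr) (auto simp: level_axis)
        also have "p + axis i (- \<sigma>) = m"
          by (simp add: p_def vec_eq_iff axis_def)
        finally show ?thesis using sum0 by simp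
      qed (rule far)
    qed
  qed
  moreover have "n \<in> C" by (simp add: C_def)
  ultimately show ?thesis by blast
qed

text \<open>Extended by zero, \<open>u\<close> satisfies the free equation except on the support of
  \<open>V\<close>, off \<Omega> and next to the complement of \<Omega>, which is a finite set. Only
  the equation at interior points is assumed, so the Robin and Dirichlet cases are both
  covered.\<close>

lemma eigenfunction_vanishes_at_cone_apex:
  fixes u :: "int ^ 'd \<Rightarrow> complex"
  assumes E: "0 < E" "E < real CARD('d)"
    and ext: "exterior_domain \<Omega>" and V: "finite {n \<in> \<Omega>. V n \<noteq> 0}"
    and S: "S \<subseteq> \<Omega>" "u \<in> ell2_on S"
    and eq: "\<And>m. m \<in> lattice_interior \<Omega> \<Longrightarrow> - laplacian u m + of_real (V m) * u m = of_real E * u m"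
    and cone: "cone_plus i n \<subseteq> \<Omega> \<or> cone_minus i n \<subseteq> \<Omega>"
  shows "u n = 0"
proof -
  have fin_compl: "finite (- \<Omega>)"
  proof -
    obtain A where "lattice_bounded A" "\<Omega> = - lattice_interior A"
      using ext by (auto simp: exterior_domain_def)
    moreover have "lattice_interior A \<subseteq> A" by (auto simp: lattice_interior_def)
    ultimately show ?thesis
      using finite_if_lattice_bounded[of A] finite_subset[of "lattice_interior A" A] by simp
  qed
  have eq': "laplacian u m + of_real E * u m = of_real (V m) * u m" if "m \<in> lattice_interior \<Omega>" for m
    using eq[OF that] by (simp add: algebra_simps)
  have "(\<lambda>n. (cmod (u n))\<^sup>2) summable_on UNIV \<longleftrightarrow> (\<lambda>n. (cmod (u n))\<^sup>2) summable_on S"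
    using S(2) by (intro summable_on_cong_neutral) (auto simp: ell2_on_def)
  then have "square_summable_on u UNIV"
    using S(2) by (simp add: ell2_on_def square_summable_on_def)
  moreover have "finite {m. laplacian u m + of_real E * u m \<noteq> 0}"
  proof (rule finite_subset)
    show "{m. laplacian u m + of_real E * u m \<noteq> 0} \<subseteq>
        {m \<in> \<Omega>. V m \<noteq> 0} \<union> - \<Omega> \<union> (\<Union>j. \<Union>s\<in>{1, -1}. (\<lambda>p. p - axis j s) ` (- \<Omega>))"
    proof (rule subsetI, rule ccontr)
      fix m assume m: "m \<in> {m. laplacian u m + of_real E * u m \<noteq> 0}"
        and not: "m \<notin> {m \<in> \<Omega>. V m \<noteq> 0} \<union> - \<Omega> \<union> (\<Union>j. \<Union>s\<in>{1, -1}. (\<lambda>p. p - axis j s) ` (- \<Omega>))"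
      have "m + axis j s \<in> \<Omega>" if "s \<in> {1, -1}" for j s
      proof (rule ccontr)
        assume "m + axis j s \<notin> \<Omega>"
        then have "m \<in> (\<lambda>p. p - axis j s) ` (- \<Omega>)"
          by (intro image_eqI[of _ _ "m + axis j s"]) auto
        then show False using not that by blast
      qed
      then have "m \<in> lattice_interior \<Omega>"
        using not by (intro lattice_interior_if_neighbours) auto
      then show False using eq'[of m] m not by auto
    qed
    show "finite ({m \<in> \<Omega>. V m \<noteq> 0} \<union> - \<Omega> \<union> (\<Union>j. \<Union>s\<in>{1, -1}. (\<lambda>p. p - axis j s) ` (- \<Omega>)))"
      using V fin_compl by (intro finite_UnI finite_UN_I finite_imageI) auto
  qed
  ultimately have fin: "finite {n. u n \<noteq> 0}"
    by (rule rellich_finite_support[OF E])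
  show ?thesis
    using cone
  proof
    assume "cone_plus i n \<subseteq> \<Omega>"
    then show ?thesis
      using eq' fin by (intro unique_continuation_cone[where \<sigma> = 1 and i = i and \<Omega> = \<Omega> and E = E and V = V]) (auto simp: cone_plus_def)
  next
    assume "cone_minus i n \<subseteq> \<Omega>"
    then show ?thesis
      using eq' fin by (intro unique_continuation_cone[where \<sigma> = "-1" and i = i and \<Omega> = \<Omega> and E = E and V = V]) (auto simp: cone_minus_def)
  qed
qed

theorem theorem2p5:
  fixes \<Omega> :: "(int ^ 'd) set" and V :: "int ^ 'd \<Rightarrow> real"
  assumes "CARD('d) \<ge> 2"
    and "exterior_domain \<Omega>" and "lattice_connected \<Omega>"
    and "finite {n \<in> \<Omega>. V n \<noteq> 0}"
  shows "(\<forall>c :: int ^ 'd \<Rightarrow> real. bounded (c ` lattice_boundary \<Omega>) \<longrightarrow> cone_condition \<Omega> \<longrightarrow>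
            point_spectrum \<Omega> (robin_op \<Omega> c V)
              \<inter> complex_of_real ` {0<..<real CARD('d)} = {}) \<and>
         ((\<forall>n\<in>lattice_interior \<Omega>. \<exists>i. cone_plus i n \<subseteq> \<Omega> \<or> cone_minus i n \<subseteq> \<Omega>) \<longrightarrow>
            point_spectrum (lattice_interior \<Omega>) (dirichlet_op \<Omega> V)
              \<inter> complex_of_real ` {0<..<real CARD('d)} = {})"
proof -
  \<comment> \<open>Used with \<open>S = \<Omega>\<close> for the Robin operator and with
    \<open>S = lattice_interior \<Omega>\<close> for the Dirichlet operator; the two operators agree
    at interior points.\<close>
  have no_eigenvalue: "point_spectrum S H \<inter> complex_of_real ` {0<..<real CARD('d)} = {}"
    if S: "S \<subseteq> \<Omega>" and H: "\<And>u m. m \<in> lattice_interior \<Omega> \<Longrightarrow> H u m = - laplacian u m + of_real (V m) * u m"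
      and cone: "\<And>n. n \<in> S \<Longrightarrow> \<exists>i. cone_plus i n \<subseteq> \<Omega> \<or> cone_minus i n \<subseteq> \<Omega>"
    for S and H :: "(int ^ 'd \<Rightarrow> complex) \<Rightarrow> int ^ 'd \<Rightarrow> complex"
  proof (rule ccontr)
    assume "point_spectrum S H \<inter> complex_of_real ` {0<..<real CARD('d)} \<noteq> {}"
    then obtain E u where E: "0 < E" "E < real CARD('d)" and u: "u \<in> ell2_on S" "u \<noteq> (\<lambda>n. 0)"
      and eigen: "H u = (\<lambda>n. of_real E * u n)"
      by (auto simp: point_spectrum_def)
    have "- laplacian u m + of_real (V m) * u m = of_real E * u m" if "m \<in> lattice_interior \<Omega>" for m
      using H[OF that, of u] eigen by simp
    then have "u n = 0" if "n \<in> S" for n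
      using cone[OF that] eigenfunction_vanishes_at_cone_apex[OF E assms(2,4) S u(1)] by blast
    moreover have "u n = 0" if "n \<notin> S" for n
      using u(1) that by (simp add: ell2_on_def)
    ultimately show False using u(2) by blast
  qed
  show ?thesis
    by (intro conjI allI impI no_eigenvalue)
       (auto simp: robin_op_def dirichlet_op_def cone_condition_def lattice_interior_def)
qed

end
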